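(* Let $L$ be a minimal $Q$-graded subalgebra of a finite-dimensional semisimple Lie algebra $\mathbb{L}$ over $\mathbb{F}$ such that $\dim H=\dim[L,L]$, and let $S=\mathbb{F}[t,t^{-1}]$. Then the derivation algebra of the loop algebra $L\otimes S$ has the decomposition $$Der(L\otimes S)=Der(L)\otimes S\;\oplus\;Cent(L)\otimes Der(S).$$ Moreover, any almost inner derivation of the loop algebra $L\otimes S$ is inner.
   Context: $\mathbb{F}$ is an algebraically closed field of characteristic $0$; $\mathbb{L}$ is a finite-dimensional semisimple Lie algebra over $\mathbb{F}$; $H$ is a fixed maximal torus, $\Phi\subset H^*$ the corresponding root system, and $\mathbb{L}=H\oplus\bigoplus_{\alpha\in\Phi}L_\alpha$ the root space decomposition. Put $Q=\mathbb{Z}\Phi$. Definition. A subalgebra $L$ of $\mathbb{L}$ containing $H$ has the form $L=H\oplus\bigoplus_{\alpha\in\Psi}L_\alpha$ with $\Psi\subseteq\Phi$. It is called a $Q$-graded subalgebra if $Q=\mathrm{span}_{\mathbb{Z}}\Psi$. A $Q$-graded subalgebra $L$ is called minimal if there is no $Q$-graded subalgebra $L_1$ of $\mathbb{L}$ with $L_1\subsetneq L$. The loop algebra is $L\otimes S$ (tensor over $\mathbb{F}$) with bracket $[x\otimes f,y\otimes g]=[x,y]\otimes fg$. $Der(A)$ denotes the $\mathbb{F}$-linear derivations of an algebra $A$. The centroid of $L$ is $Cent(L)=\{\varphi\in End(L):\varphi[x,y]=[\varphi(x),y]=[x,\varphi(y)]\ \forall x,y\in L\}$. In the decomposition, $D\otimes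 s\in Der(L)\otimes S$ is identified with the map $x\otimes f\mapsto D(x)\otimes sf$, and $\lambda\otimes d\in Cent(L)\otimes Der(S)$ with the map $x\otimes f\mapsto\lambda(x)\otimes d(f)$. A derivation $D$ of a Lie algebra $M$ is almost inner if $D(x)\in[x,M]=\{[x,y]:y\in M\}$ for all $x\in M$. *)

theory Defs
  imports
    "HOL-Library.Function_Algebras"
    "HOL-Library.Poly_Mapping"
    "HOL-Computational_Algebra.Polynomial"
    "HOL-Computational_Algebra.Group_Closure"
begin

text \<open>
  A vector space is an abelian group type with an explicit scalar multiplication, as in the
  library locale \<^locale>\<open>vector_space\<close>; a (Lie) algebra carries a product in addition.
  Subalgebras are sets.  Linear maps defined on a subspace \<open>V\<close> are represented by the functions
  that are linear on \<open>V\<close> and take the value \<open>0\<close> outside \<open>V\<close>.  Thus two maps on \<open>V\<close> are equal iff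
  they are equal as functions, and linear combinations of maps are the pointwise ones.
\<close>

section \<open>Linear maps, derivations, centroid\<close>

definition linear_maps ::
  "('f \<Rightarrow> 'v \<Rightarrow> 'v) \<Rightarrow> ('v::ab_group_add) set \<Rightarrow> ('f \<Rightarrow> 'w \<Rightarrow> 'w) \<Rightarrow> ('w::ab_group_add) set
    \<Rightarrow> ('v \<Rightarrow> 'w) set" where
  "linear_maps s1 V s2 W = {\<phi>.
     (\<forall>x\<in>V. \<phi> x \<in> W) \<and>
     (\<forall>x\<in>V. \<forall>y\<in>V. \<phi> (x + y) = \<phi> x + \<phi> y) \<and>
     (\<forall>c. \<forall>x\<in>V. \<phi> (s1 c x) = s2 c (\<phi> x)) \<and>
     (\<forall>x. x \<notin> V \<longrightarrow> \<phi> x = 0)}"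

definition fun_scale :: "('f \<Rightarrow> 'w \<Rightarrow> 'w) \<Rightarrow> 'f \<Rightarrow> ('v \<Rightarrow> 'w) \<Rightarrow> 'v \<Rightarrow> 'w" where
  "fun_scale s c \<phi> = (\<lambda>x. s c (\<phi> x))"

definition Der ::
  "('f \<Rightarrow> 'v \<Rightarrow> 'v) \<Rightarrow> ('v \<Rightarrow> 'v \<Rightarrow> 'v) \<Rightarrow> ('v::ab_group_add) set \<Rightarrow> ('v \<Rightarrow> 'v) set" where
  "Der s m M = {D \<in> linear_maps s M s M.
     \<forall>x\<in>M. \<forall>y\<in>M. D (m x y) = m (D x) y + m x (D y)}"

definition Cent ::
  "('f \<Rightarrow> 'v \<Rightarrow> 'v) \<Rightarrow> ('v \<Rightarrow> 'v \<Rightarrow> 'v) \<Rightarrow> ('v::ab_group_add) set \<Rightarrow> ('v \<Rightarrow> 'v) set" where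
  "Cent s m M = {\<phi> \<in> linear_maps s M s M.
     \<forall>x\<in>M. \<forall>y\<in>M. \<phi> (m x y) = m (\<phi> x) y \<and> \<phi> (m x y) = m x (\<phi> y)}"

definition almost_inner_derivation :: "('v \<Rightarrow> 'v \<Rightarrow> 'v) \<Rightarrow> 'v set \<Rightarrow> ('v \<Rightarrow> 'v) \<Rightarrow> bool" where
  "almost_inner_derivation m M D \<longleftrightarrow> (\<forall>x\<in>M. D x \<in> {m x y | y. y \<in> M})"

definition inner_derivation :: "('v \<Rightarrow> 'v \<Rightarrow> 'v) \<Rightarrow> 'v set \<Rightarrow> ('v \<Rightarrow> 'v) \<Rightarrow> bool" where
  "inner_derivation m M D \<longleftrightarrow> (\<exists>y\<in>M. \<forall>x\<in>M. D x = m y x)"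


section \<open>Lie algebras\<close>

locale lie_algebra = vector_space scale
  for scale :: "'f::field \<Rightarrow> 'a::ab_group_add \<Rightarrow> 'a" (infixr \<open>*s\<close> 75) +
  fixes br :: "'a \<Rightarrow> 'a \<Rightarrow> 'a"
  assumes br_add_left: "br (x + y) z = br x z + br y z"
    and br_add_right: "br x (y + z) = br x y + br x z"
    and br_scale_left: "br (c *s x) y = c *s br x y"
    and br_scale_right: "br x (c *s y) = c *s br x y"
    and br_self: "br x x = 0"
    and jacobi: "br x (br y z) + br y (br z x) + br z (br x y) = 0"

definition subalgebra ::
  "('f::comm_ring_1 \<Rightarrow> 'a::ab_group_add \<Rightarrow> 'a) \<Rightarrow> ('a \<Rightarrow> 'a \<Rightarrow> 'a) \<Rightarrow> 'a set \<Rightarrow> bool" where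
  "subalgebra s br L \<longleftrightarrow> module.subspace s L \<and> (\<forall>x\<in>L. \<forall>y\<in>L. br x y \<in> L)"

definition lie_ideal ::
  "('f::comm_ring_1 \<Rightarrow> 'a::ab_group_add \<Rightarrow> 'a) \<Rightarrow> ('a \<Rightarrow> 'a \<Rightarrow> 'a) \<Rightarrow> 'a set \<Rightarrow> bool" where
  "lie_ideal s br I \<longleftrightarrow> module.subspace s I \<and> (\<forall>x. \<forall>y\<in>I. br x y \<in> I)"

definition derived_algebra ::
  "('f::comm_ring_1 \<Rightarrow> 'a::ab_group_add \<Rightarrow> 'a) \<Rightarrow> ('a \<Rightarrow> 'a \<Rightarrow> 'a) \<Rightarrow> 'a set \<Rightarrow> 'a set" where
  "derived_algebra s br L = module.span s {br x y | x y. x \<in> L \<and> y \<in> L}"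

definition solvable ::
  "('f::comm_ring_1 \<Rightarrow> 'a::ab_group_add \<Rightarrow> 'a) \<Rightarrow> ('a \<Rightarrow> 'a \<Rightarrow> 'a) \<Rightarrow> 'a set \<Rightarrow> bool" where
  "solvable s br L \<longleftrightarrow> (\<exists>n. (derived_algebra s br ^^ n) L = {0})"

text \<open>Vanishing of the radical: the largest solvable ideal is zero.\<close>
definition semisimple ::
  "('f::comm_ring_1 \<Rightarrow> 'a::ab_group_add \<Rightarrow> 'a) \<Rightarrow> ('a \<Rightarrow> 'a \<Rightarrow> 'a) \<Rightarrow> bool" where
  "semisimple s br \<longleftrightarrow> (\<forall>I. lie_ideal s br I \<and> solvable s br I \<longrightarrow> I = {0})"


section \<open>Maximal tori, roots, Q-graded subalgebras\<close>

definition diagonalizable ::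
  "('f::field \<Rightarrow> 'a::ab_group_add \<Rightarrow> 'a) \<Rightarrow> ('a \<Rightarrow> 'a) \<Rightarrow> bool" where
  "diagonalizable s T \<longleftrightarrow> (\<exists>B. \<not> module.dependent s B \<and> module.span s B = UNIV \<and>
     (\<forall>b\<in>B. \<exists>c. T b = s c b))"

text \<open>Over an algebraically closed field semisimple endomorphisms are the diagonalizable ones.\<close>
definition torus ::
  "('f::field \<Rightarrow> 'a::ab_group_add \<Rightarrow> 'a) \<Rightarrow> ('a \<Rightarrow> 'a \<Rightarrow> 'a) \<Rightarrow> 'a set \<Rightarrow> bool" where
  "torus s br H \<longleftrightarrow> subalgebra s br H \<and> (\<forall>h\<in>H. diagonalizable s (br h))"

definition maximal_torus ::
  "('f::field \<Rightarrow> 'a::ab_group_add \<Rightarrow> 'a) \<Rightarrow> ('a \<Rightarrow> 'a \<Rightarrow> 'a) \<Rightarrow> 'a set \<Rightarrow> bool" where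
  "maximal_torus s br H \<longleftrightarrow> torus s br H \<and> \<not> (\<exists>H'. torus s br H' \<and> H \<subset> H')"

definition root_space ::
  "('f \<Rightarrow> 'a \<Rightarrow> 'a) \<Rightarrow> ('a \<Rightarrow> 'a \<Rightarrow> 'a) \<Rightarrow> 'a set \<Rightarrow> ('a \<Rightarrow> 'f) \<Rightarrow> 'a set" where
  "root_space s br H \<alpha> = {x. \<forall>h\<in>H. br h x = s (\<alpha> h) x}"

definition roots ::
  "('f::field \<Rightarrow> 'a::ab_group_add \<Rightarrow> 'a) \<Rightarrow> ('a \<Rightarrow> 'a \<Rightarrow> 'a) \<Rightarrow> 'a set \<Rightarrow> ('a \<Rightarrow> 'f) set" where
  "roots s br H =
     {\<alpha> \<in> linear_maps s H (*) UNIV. \<alpha> \<noteq> 0 \<and> root_space s br H \<alpha> \<noteq> {0}}"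

text \<open>
  The sum \<open>H + (\<Sum>\<alpha>\<in>\<Psi>. L\<^sub>\<alpha>)\<close> is written as a span; it is automatically direct, since \<open>H\<close> lies in
  the zero weight space and weight spaces for distinct weights are independent.
  \<^const>\<open>group_closure\<close> is the integer span, taken in the space of functionals on \<open>H\<close>.
\<close>
definition Q_graded ::
  "('f::field \<Rightarrow> 'a::ab_group_add \<Rightarrow> 'a) \<Rightarrow> ('a \<Rightarrow> 'a \<Rightarrow> 'a) \<Rightarrow> 'a set \<Rightarrow> 'a set \<Rightarrow> bool" where
  "Q_graded s br H L \<longleftrightarrow> subalgebra s br L \<and> H \<subseteq> L \<and>
     (\<exists>\<Psi> \<subseteq> roots s br H.
        L = module.span s (H \<union> (\<Union>\<alpha>\<in>\<Psi>. root_space s br H \<alpha>)) \<and>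
        group_closure \<Psi> = group_closure (roots s br H))"

definition minimal_Q_graded ::
  "('f::field \<Rightarrow> 'a::ab_group_add \<Rightarrow> 'a) \<Rightarrow> ('a \<Rightarrow> 'a \<Rightarrow> 'a) \<Rightarrow> 'a set \<Rightarrow> 'a set \<Rightarrow> bool" where
  "minimal_Q_graded s br H L \<longleftrightarrow> Q_graded s br H L \<and>
     \<not> (\<exists>L1. Q_graded s br H L1 \<and> L1 \<subset> L)"


section \<open>Laurent polynomials and loop algebras\<close>

text \<open>
  The ring of Laurent polynomials over \<open>'f\<close> is \<open>int \<Rightarrow>\<^sub>0 'f\<close> with its library (convolution) product;
  \<open>Poly_Mapping.single n c\<close> is the monomial with coefficient \<open>c\<close> and exponent \<open>n\<close>.
  The tensor product of \<open>L\<close> with this ring is realised as the space of Laurent polynomials with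
  coefficients in \<open>L\<close>, i.e. as the set of all \<open>p :: int \<Rightarrow>\<^sub>0 'a\<close> with coefficients in \<open>L\<close>.  The lemmas
  \<open>tensor_bilinear\<close>, \<open>loop_lift_exists\<close>, \<open>loop_lift_unique\<close> and \<open>loop_br_tensor\<close> below show that this
  is the tensor product and that the bracket is the required one.
\<close>

type_synonym 'f laurent_poly = "int \<Rightarrow>\<^sub>0 'f"

definition pm_scale :: "('f \<Rightarrow> 'v \<Rightarrow> 'v) \<Rightarrow> 'f \<Rightarrow> (int \<Rightarrow>\<^sub>0 'v::zero) \<Rightarrow> (int \<Rightarrow>\<^sub>0 'v)" where
  "pm_scale s c p = Poly_Mapping.map (s c) p"

abbreviation laurent_scale :: "'f::field \<Rightarrow> 'f laurent_poly \<Rightarrow> 'f laurent_poly" where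
  "laurent_scale \<equiv> pm_scale (*)"

definition loop :: "'a::zero set \<Rightarrow> (int \<Rightarrow>\<^sub>0 'a) set" where
  "loop L = {p. \<forall>n. Poly_Mapping.lookup p n \<in> L}"

definition tensor ::
  "('f::zero \<Rightarrow> 'a \<Rightarrow> 'a) \<Rightarrow> 'a::zero \<Rightarrow> 'f laurent_poly \<Rightarrow> (int \<Rightarrow>\<^sub>0 'a)" where
  "tensor s x f = Poly_Mapping.map (\<lambda>c. s c x) f"

definition loop_br ::
  "('a \<Rightarrow> 'a \<Rightarrow> 'a) \<Rightarrow> (int \<Rightarrow>\<^sub>0 'a::ab_group_add) \<Rightarrow> (int \<Rightarrow>\<^sub>0 'a) \<Rightarrow> (int \<Rightarrow>\<^sub>0 'a)" where
  "loop_br br p q = (\<Sum>m\<in>Poly_Mapping.keys p. \<Sum>n\<in>Poly_Mapping.keys q.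
     Poly_Mapping.single (m + n) (br (Poly_Mapping.lookup p m) (Poly_Mapping.lookup q n)))"

text \<open>
  For \<open>D\<close> linear on \<open>L\<close> and \<open>g\<close> linear on Laurent polynomials, this is the map on the loop algebra
  sending a pure tensor of \<open>x\<close> and \<open>f\<close> to that of \<open>D x\<close> and \<open>g f\<close> (lemma \<open>tensor_map_tensor\<close>).
\<close>
definition tensor_map ::
  "('f::field \<Rightarrow> 'a \<Rightarrow> 'a) \<Rightarrow> 'a::ab_group_add set \<Rightarrow> ('a \<Rightarrow> 'a) \<Rightarrow>
   ('f laurent_poly \<Rightarrow> 'f laurent_poly) \<Rightarrow> (int \<Rightarrow>\<^sub>0 'a) \<Rightarrow> (int \<Rightarrow>\<^sub>0 'a)" where
  "tensor_map s L D g p = (if p \<in> loop L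
     then \<Sum>n\<in>Poly_Mapping.keys p.
       tensor s (D (Poly_Mapping.lookup p n)) (g (Poly_Mapping.single n 1))
     else 0)"

abbreviation Der_laurent :: "('f::field laurent_poly \<Rightarrow> 'f laurent_poly) set" where
  "Der_laurent \<equiv> Der laurent_scale (*) UNIV"

text \<open>
  The next two are the tensor products of \<open>Der L\<close> with the Laurent polynomials and of \<open>Cent L\<close> with
  the derivations of the Laurent polynomials, as subspaces of the linear maps on the loop algebra.
  By lemma \<open>tensor_map_inj\<close> no information is lost in this identification.
\<close>
definition Der_tensor_laurent ::
  "('f::field \<Rightarrow> 'a \<Rightarrow> 'a) \<Rightarrow> ('a \<Rightarrow> 'a \<Rightarrow> 'a) \<Rightarrow> 'a::ab_group_add set \<Rightarrow>
   ((int \<Rightarrow>\<^sub>0 'a) \<Rightarrow> (int \<Rightarrow>\<^sub>0 'a)) set" where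
  "Der_tensor_laurent s br L = module.span (fun_scale (pm_scale s))
     {tensor_map s L D (\<lambda>f. u * f) | D u. D \<in> Der s br L}"

definition Cent_tensor_Der_laurent ::
  "('f::field \<Rightarrow> 'a \<Rightarrow> 'a) \<Rightarrow> ('a \<Rightarrow> 'a \<Rightarrow> 'a) \<Rightarrow> 'a::ab_group_add set \<Rightarrow>
   ((int \<Rightarrow>\<^sub>0 'a) \<Rightarrow> (int \<Rightarrow>\<^sub>0 'a)) set" where
  "Cent_tensor_Der_laurent s br L = module.span (fun_scale (pm_scale s))
     {tensor_map s L \<phi> d | \<phi> d. \<phi> \<in> Cent s br L \<and> d \<in> Der_laurent}"


section \<open>The loop algebra is a tensor product\<close>

context vector_space
begin

lemma lookup_pm_scale [simp]:
  "Poly_Mapping.lookup (pm_scale scale c p) n = scale c (Poly_Mapping.lookup p n)"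
  by (simp add: pm_scale_def Poly_Mapping.map.rep_eq when_def)

lemma lookup_tensor [simp]:
  "Poly_Mapping.lookup (tensor scale x f) n = scale (Poly_Mapping.lookup f n) x"
  by (simp add: tensor_def Poly_Mapping.map.rep_eq when_def)

lemma vector_space_pm_scale: "vector_space (pm_scale scale)"
  by unfold_locales
    (auto intro!: poly_mapping_eqI simp: lookup_add scale_right_distrib scale_left_distrib)

lemma vector_space_fun_scale: "vector_space (fun_scale scale)"
  by unfold_locales
    (auto simp: fun_scale_def fun_eq_iff scale_right_distrib scale_left_distrib)

lemma subspace_loop: "subspace L \<Longrightarrow> module.subspace (pm_scale scale) (loop L)"
proof -
  assume L: "subspace L"
  interpret P: vector_space "pm_scale scale" by (rule vector_space_pm_scale)
  show ?thesis
    using L by (auto simp: P.subspace_def loop_def lookup_add subspace_0 subspace_add subspace_scale)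
qed

end

lemma lookup_laurent_scale [simp]:
  fixes f :: "'f::field laurent_poly"
  shows "Poly_Mapping.lookup (laurent_scale c f) n = c * Poly_Mapping.lookup f n"
  by (simp add: pm_scale_def Poly_Mapping.map.rep_eq when_def)

context vector_space
begin

lemma tensor_bilinear:
  "tensor scale (x + y) f = tensor scale x f + tensor scale y f"
  "tensor scale (scale c x) f = pm_scale scale c (tensor scale x f)"
  "tensor scale x (f + g) = tensor scale x f + tensor scale x g"
  "tensor scale x (laurent_scale c f) = pm_scale scale c (tensor scale x f)"
  by (auto intro!: poly_mapping_eqI
      simp: lookup_add scale_right_distrib scale_left_distrib mult.commute)

lemma tensor_in_loop: "subspace L \<Longrightarrow> x \<in> L \<Longrightarrow> tensor scale x f \<in> loop L"
  by (simp add: loop_def subspace_scale)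

lemma tensor_single: "tensor scale x (Poly_Mapping.single n c) = Poly_Mapping.single n (scale c x)"
  by (rule poly_mapping_eqI) (simp add: lookup_single when_def)

lemma loop_eq_sum_tensor:
  "p = (\<Sum>n\<in>Poly_Mapping.keys p.
     tensor scale (Poly_Mapping.lookup p n) (Poly_Mapping.single n 1))"
  by (rule poly_mapping_eqI)
    (simp add: lookup_sum tensor_single lookup_single when_def in_keys_iff)

end

lemma sum_keys_mono:
  fixes F :: "int \<Rightarrow> 'v::zero \<Rightarrow> 'w::comm_monoid_add"
  assumes "finite K" "Poly_Mapping.keys p \<subseteq> K" "\<And>n. F n 0 = 0"
  shows "(\<Sum>n\<in>Poly_Mapping.keys p. F n (Poly_Mapping.lookup p n))
       = (\<Sum>n\<in>K. F n (Poly_Mapping.lookup p n))"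
  using assms by (intro sum.mono_neutral_left) (auto simp: in_keys_iff)

lemma sum_keys_linear:
  fixes F :: "int \<Rightarrow> 'a::ab_group_add \<Rightarrow> 'w::ab_group_add"
  assumes "vector_space scale" "module.subspace scale L" "vector_space w"
    and F: "\<And>n x y. x \<in> L \<Longrightarrow> y \<in> L \<Longrightarrow> F n (x + y) = F n x + F n y"
      "\<And>n c x. x \<in> L \<Longrightarrow> F n (scale c x) = w c (F n x)"
  defines "T \<equiv> \<lambda>p. \<Sum>n\<in>Poly_Mapping.keys p. F n (Poly_Mapping.lookup p n)"
  shows "p \<in> loop L \<Longrightarrow> q \<in> loop L \<Longrightarrow> T (p + q) = T p + T q"
    and "p \<in> loop L \<Longrightarrow> T (pm_scale scale c p) = w c (T p)"
proof -
  interpret vector_space scale by fact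
  interpret W: vector_space w by fact
  have z: "F n 0 = 0" for n
    using F(2)[of 0 n 0] subspace_0[OF assms(2)] by simp
  {
    assume p: "p \<in> loop L" and q: "q \<in> loop L"
    let ?K = "Poly_Mapping.keys p \<union> Poly_Mapping.keys q"
    have "T (p + q) = (\<Sum>n\<in>?K. F n (Poly_Mapping.lookup (p + q) n))"
      unfolding T_def by (rule sum_keys_mono) (use keys_add[of p q] z in auto)
    also have "\<dots> = (\<Sum>n\<in>?K. F n (Poly_Mapping.lookup p n) + F n (Poly_Mapping.lookup q n))"
      using p q by (intro sum.cong) (auto simp: lookup_add F loop_def)
    also have "\<dots> = T p + T q"
      unfolding T_def sum.distrib
      by (intro arg_cong2[where f = "(+)"] sum_keys_mono[symmetric]) (auto simp: z)
    finally show "T (p + q) = T p + T q" .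
  next
    assume p: "p \<in> loop L"
    have "T (pm_scale scale c p)
        = (\<Sum>n\<in>Poly_Mapping.keys p. F n (Poly_Mapping.lookup (pm_scale scale c p) n))"
      unfolding T_def by (rule sum_keys_mono) (auto simp: z in_keys_iff)
    also have "\<dots> = w c (T p)"
      using p by (simp add: T_def W.scale_sum_right F loop_def)
    finally show "T (pm_scale scale c p) = w c (T p)" .
  }
qed

lemma laurent_eq_sum:
  fixes f :: "'f::field laurent_poly"
  shows "f = (\<Sum>n\<in>Poly_Mapping.keys f. laurent_scale (Poly_Mapping.lookup f n) (Poly_Mapping.single n 1))"
  by (rule poly_mapping_eqI)
    (simp add: lookup_sum lookup_single when_def in_keys_iff if_distrib cong: if_cong)

lemma laurent_linear_expand:
  fixes g :: "'f::field laurent_poly \<Rightarrow> 'w::ab_group_add"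
  assumes "vector_space w" "\<And>f f'. g (f + f') = g f + g f'" "\<And>c f. g (laurent_scale c f) = w c (g f)"
  shows "g f = (\<Sum>n\<in>Poly_Mapping.keys f. w (Poly_Mapping.lookup f n) (g (Poly_Mapping.single n 1)))"
proof -
  interpret W: vector_space w by fact
  have z: "g 0 = 0" using assms(2)[of 0 0] by simp
  have "g (\<Sum>n\<in>K. h n) = (\<Sum>n\<in>K. g (h n))" for K :: "int set" and h
    by (induction K rule: infinite_finite_induct) (auto simp: z assms(2))
  from this[of "\<lambda>n. laurent_scale (Poly_Mapping.lookup f n) (Poly_Mapping.single n 1)"
      "Poly_Mapping.keys f"]
  show ?thesis by (simp add: laurent_eq_sum[symmetric] assms(3))
qed

text \<open>Universal property of the tensor product.\<close>

lemma loop_lift_exists: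
  fixes scale :: "'f::field \<Rightarrow> 'a::ab_group_add \<Rightarrow> 'a" and w :: "'f \<Rightarrow> 'w::ab_group_add \<Rightarrow> 'w"
    and \<beta> :: "'a \<Rightarrow> 'f laurent_poly \<Rightarrow> 'w"
  assumes "vector_space scale" "module.subspace scale L" "vector_space w"
    and \<beta>: "\<And>x y f. x \<in> L \<Longrightarrow> y \<in> L \<Longrightarrow> \<beta> (x + y) f = \<beta> x f + \<beta> y f"
      "\<And>c x f. x \<in> L \<Longrightarrow> \<beta> (scale c x) f = w c (\<beta> x f)"
      "\<And>x f g. x \<in> L \<Longrightarrow> \<beta> x (f + g) = \<beta> x f + \<beta> x g"
      "\<And>c x f. x \<in> L \<Longrightarrow> \<beta> x (laurent_scale c f) = w c (\<beta> x f)"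
  shows "\<exists>T \<in> linear_maps (pm_scale scale) (loop L) w UNIV. \<forall>x\<in>L. \<forall>f. T (tensor scale x f) = \<beta> x f"
proof -
  interpret vector_space scale by fact
  interpret W: vector_space w by fact
  interpret P: vector_space "pm_scale scale" by (rule vector_space_pm_scale)
  note subL = assms(2)
  note subP = subspace_loop[OF subL]
  define T0 where "T0 = (\<lambda>p. \<Sum>n\<in>Poly_Mapping.keys p. \<beta> (Poly_Mapping.lookup p n) (Poly_Mapping.single n 1))"
  define T where "T = (\<lambda>p. if p \<in> loop L then T0 p else 0)"
  have lin: "p \<in> loop L \<Longrightarrow> q \<in> loop L \<Longrightarrow> T0 (p + q) = T0 p + T0 q"
    "p \<in> loop L \<Longrightarrow> T0 (pm_scale scale c p) = w c (T0 p)" for p q c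
    unfolding T0_def
    by (rule sum_keys_linear[where scale = scale and w = w and F = "\<lambda>n x. \<beta> x (Poly_Mapping.single n 1)" and L = L];
        use assms in auto)+
  have "T \<in> linear_maps (pm_scale scale) (loop L) w UNIV"
    unfolding linear_maps_def T_def using subP
    by (auto simp: lin P.subspace_add P.subspace_scale)
  moreover have "T (tensor scale x f) = \<beta> x f" if x: "x \<in> L" for x f
  proof -
    have z: "\<beta> 0 f = 0" for f
      using \<beta>(2)[OF subspace_0[OF subL], of 0] by simp
    have "T (tensor scale x f) = T0 (tensor scale x f)"
      by (simp add: T_def tensor_in_loop subL x)
    also have "\<dots> = (\<Sum>n\<in>Poly_Mapping.keys f. \<beta> (Poly_Mapping.lookup (tensor scale x f) n) (Poly_Mapping.single n 1))"
      unfolding T0_def by (rule sum_keys_mono) (auto simp: z in_keys_iff)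
    also have "\<dots> = \<beta> x f"
      using laurent_linear_expand[of w "\<beta> x" f] assms(3) x by (simp add: \<beta>)
    finally show ?thesis .
  qed
  ultimately show ?thesis by blast
qed

lemma loop_lift_unique:
  fixes scale :: "'f::field \<Rightarrow> 'a::ab_group_add \<Rightarrow> 'a" and w :: "'f \<Rightarrow> 'w::ab_group_add \<Rightarrow> 'w"
  assumes "vector_space scale" "module.subspace scale L"
    and T: "T \<in> linear_maps (pm_scale scale) (loop L) w UNIV"
      "T' \<in> linear_maps (pm_scale scale) (loop L) w UNIV"
    and eq: "\<And>x f. x \<in> L \<Longrightarrow> T (tensor scale x f) = T' (tensor scale x f)"
  shows "T = T'"
proof
  interpret vector_space scale by fact
  interpret P: vector_space "pm_scale scale" by (rule vector_space_pm_scale)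
  note subL = assms(2)
  note subP = subspace_loop[OF subL]
  fix p
  show "T p = T' p"
  proof (cases "p \<in> loop L")
    case True
    have z: "U 0 = 0" if "U \<in> linear_maps (pm_scale scale) (loop L) w UNIV" for U
    proof -
      have "U (0 + 0) = U 0 + U 0"
        using that P.subspace_0[OF subP] unfolding linear_maps_def by blast
      thus ?thesis by simp
    qed
    let ?t = "\<lambda>n. tensor scale (Poly_Mapping.lookup p n) (Poly_Mapping.single n 1)"
    have t: "?t n \<in> loop L" for n
      using True by (intro tensor_in_loop subL) (auto simp: loop_def)
    have ex: "U (\<Sum>n\<in>K. ?t n) = (\<Sum>n\<in>K. U (?t n))"
      if U: "U \<in> linear_maps (pm_scale scale) (loop L) w UNIV" for U K
    proof (induction K rule: infinite_finite_induct)
      case (insert n K)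
      have "U (?t n + (\<Sum>n\<in>K. ?t n)) = U (?t n) + U (\<Sum>n\<in>K. ?t n)"
        using U t[of n] P.subspace_sum[OF subP, of K ?t] t unfolding linear_maps_def by blast
      with insert show ?case by simp
    qed (auto simp: z[OF U])
    have "T (?t n) = T' (?t n)" for n
      by (rule eq) (use True in \<open>auto simp: loop_def\<close>)
    hence "T (\<Sum>n\<in>Poly_Mapping.keys p. ?t n) = T' (\<Sum>n\<in>Poly_Mapping.keys p. ?t n)"
      by (simp add: ex T)
    thus ?thesis by (simp add: loop_eq_sum_tensor[symmetric])
  next
    case False
    thus ?thesis using T by (simp add: linear_maps_def)
  qed
qed

lemma (in lie_algebra) loop_br_tensor:
  "loop_br br (tensor scale x f) (tensor scale y g) = tensor scale (br x y) (f * g)"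
proof -
  have z: "br 0 u = 0" "br u 0 = 0" for u
    using br_scale_left[of 0 0 u] br_scale_right[of u 0 0] by auto
  have fg: "f * g = (\<Sum>m\<in>Poly_Mapping.keys f. \<Sum>n\<in>Poly_Mapping.keys g.
      Poly_Mapping.single (m + n) (Poly_Mapping.lookup f m * Poly_Mapping.lookup g n))"
  proof -
    have s: "h = (\<Sum>n\<in>Poly_Mapping.keys h. Poly_Mapping.single n (Poly_Mapping.lookup h n))"
      for h :: "'f laurent_poly"
      by (rule poly_mapping_eqI) (simp add: lookup_sum lookup_single when_def in_keys_iff)
    have "f * g = (\<Sum>n\<in>Poly_Mapping.keys f. Poly_Mapping.single n (Poly_Mapping.lookup f n))
      * (\<Sum>n\<in>Poly_Mapping.keys g. Poly_Mapping.single n (Poly_Mapping.lookup g n))"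
      using s[of f] s[of g] by simp
    thus ?thesis by (simp add: sum_product mult_single)
  qed
  have "loop_br br (tensor scale x f) (tensor scale y g)
     = (\<Sum>m\<in>Poly_Mapping.keys f. \<Sum>n\<in>Poly_Mapping.keys (tensor scale y g).
     Poly_Mapping.single (m + n) (br (Poly_Mapping.lookup (tensor scale x f) m) (Poly_Mapping.lookup (tensor scale y g) n)))"
    unfolding loop_br_def
    by (rule sum_keys_mono[where F = "\<lambda>m u. \<Sum>n\<in>Poly_Mapping.keys (tensor scale y g).
     Poly_Mapping.single (m + n) (br u (Poly_Mapping.lookup (tensor scale y g) n))"]) (auto simp: z in_keys_iff)
  also have "\<dots> = (\<Sum>m\<in>Poly_Mapping.keys f. \<Sum>n\<in>Poly_Mapping.keys g.
     Poly_Mapping.single (m + n) (br (Poly_Mapping.lookup (tensor scale x f) m) (Poly_Mapping.lookup (tensor scale y g) n)))"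
    by (intro sum.cong refl sum_keys_mono) (auto simp: z in_keys_iff)
  also have "\<dots> = tensor scale (br x y) (f * g)"
    by (rule poly_mapping_eqI)
      (simp add: fg lookup_sum lookup_single when_def br_scale_left br_scale_right scale_sum_left
        if_distrib[of "\<lambda>c. c *s br x y"] mult.commute cong: if_cong)
  finally show ?thesis .
qed

lemma tensor_map_tensor:
  assumes "vector_space scale" "module.subspace scale L"
    and D: "D \<in> linear_maps scale L scale L"
    and g: "g \<in> linear_maps laurent_scale UNIV laurent_scale UNIV"
    and x: "x \<in> L"
  shows "tensor_map scale L D g (tensor scale x f) = tensor scale (D x) (g f)"
proof -
  interpret vector_space scale by fact
  have "D 0 = 0"
    using D subspace_0[OF assms(2)] unfolding linear_maps_def
    by (metis (mono_tags, lifting) mem_Collect_eq scale_zero_left)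
  hence z: "tensor scale (D 0) h = 0" for h
    by (simp add: poly_mapping_eq_iff fun_eq_iff)
  have "tensor_map scale L D g (tensor scale x f) = (\<Sum>n\<in>Poly_Mapping.keys f.
       tensor scale (D (Poly_Mapping.lookup (tensor scale x f) n)) (g (Poly_Mapping.single n 1)))"
    unfolding tensor_map_def using tensor_in_loop[OF assms(2) x]
    by (simp del: lookup_tensor, intro sum_keys_mono) (auto simp: z in_keys_iff)
  also have "\<dots> = (\<Sum>n\<in>Poly_Mapping.keys f.
       pm_scale scale (Poly_Mapping.lookup f n) (tensor scale (D x) (g (Poly_Mapping.single n 1))))"
    using D x by (simp add: linear_maps_def tensor_bilinear)
  also have "\<dots> = tensor scale (D x) (g f)"
    using laurent_linear_expand[OF vector_space_pm_scale, of "\<lambda>f. tensor scale (D x) (g f)" f] g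
    by (simp add: linear_maps_def tensor_bilinear)
  finally show ?thesis .
qed

text \<open>
  The identification of the algebraic tensor product of spaces of linear maps with a space of maps
  on the loop algebra is injective.
\<close>
lemma tensor_map_inj:
  fixes scale :: "'f::field \<Rightarrow> 'a::ab_group_add \<Rightarrow> 'a"
  assumes "vector_space scale" "module.subspace scale L" "finite I"
    and D: "\<And>i. i \<in> I \<Longrightarrow> D i \<in> linear_maps scale L scale L"
    and g: "\<And>i. i \<in> I \<Longrightarrow> g i \<in> linear_maps laurent_scale UNIV laurent_scale UNIV"
    and indep: "\<And>c. (\<Sum>i\<in>I. fun_scale scale (c i) (D i)) = 0 \<Longrightarrow> \<forall>i\<in>I. c i = 0"
    and eq: "(\<Sum>i\<in>I. tensor_map scale L (D i) (g i)) = 0"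
    and i: "i \<in> I"
  shows "g i = 0"
proof
  interpret vector_space scale by fact
  have app: "(\<Sum>i\<in>I. h i) x = (\<Sum>i\<in>I. h i x)" for h :: "_ \<Rightarrow> 'x \<Rightarrow> 'y::ab_group_add" and x
    using \<open>finite I\<close> by (induction I rule: finite_induct) auto
  fix f
  have "Poly_Mapping.lookup (g i f) m = 0" for m
  proof -
    have "(\<Sum>i\<in>I. fun_scale scale (Poly_Mapping.lookup (g i f) m) (D i)) = 0"
    proof
      fix x
      show "(\<Sum>i\<in>I. fun_scale scale (Poly_Mapping.lookup (g i f) m) (D i)) x = 0 x"
      proof (cases "x \<in> L")
        case True
        have "0 = Poly_Mapping.lookup ((\<Sum>i\<in>I. tensor_map scale L (D i) (g i)) (tensor scale x f)) m"
          by (simp add: eq)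
        also have "\<dots> = (\<Sum>i\<in>I. scale (Poly_Mapping.lookup (g i f) m) (D i x))"
          by (simp add: app lookup_sum tensor_map_tensor[OF assms(1,2) D g True])
        finally show ?thesis by (simp add: app fun_scale_def)
      next
        case False
        thus ?thesis using D by (simp add: app fun_scale_def linear_maps_def)
      qed
    qed
    from indep[OF this] i show ?thesis by blast
  qed
  thus "g i f = 0 f" by (simp add: poly_mapping_eq_iff fun_eq_iff)
qed

end

(* Write L = H + sum of the root spaces for Psi.  Since Psi generates the root lattice and a semisimple
   algebra has no center, Psi spans the dual of H; as [L, L] contains all these root spaces,
   dim [L, L] = dim H forces Psi to be a basis of the dual of H and the root spaces to be lines.  With
   the dual basis (h_i) of H and root vectors e_i, L is the direct sum of the algebras spanned by h_i
   and e_i with [h_i, e_i] = e_i.  Applying a derivation D of the loop algebra to the relations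
   [h_i g, e_j f] = delta_ij e_i fg and [h_i g, h_j] = 0 yields
     D (h_i f) = d_i(f) h_i + b_i f e_i   and   D (e_i f) = (d_i(f) + p_i f) e_i
   with d_i a derivation of S and b_i, p_i in S.  If D is almost inner then all d_i vanish and D is the
   bracket with the sum of the p_i h_i - b_i e_i. *)

theory Submission
  imports Defs
begin

section \<open>Linear maps on loop algebras\<close>

text \<open>Semisimplicity enters through ad h being nonzero for nonzero h in H: a common
  eigenvector of ad H inside the range of ad h yields a root that does not vanish at h. Thus common
  eigenvectors take the place of the full root space decomposition. The formulas for D match the two
  summands as follows. The derivation d_i acts alike on h_i and e_i, so it is tensored with the
  projection to the i-th summand of L, which lies in the centroid. The factors p_i and b_i multiply
  the derivations ad h_i and -ad e_i of L. The sum is direct because the first summand consists of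
  S-linear maps, while the second kills every x \<otimes> 1.\<close>

lemma sum_fun_apply: "(\<Sum>i\<in>I. h i) x = (\<Sum>i\<in>I. h i x)" for h :: "'i \<Rightarrow> 'x \<Rightarrow> 'y::comm_monoid_add"
  by (induction I rule: infinite_finite_induct) auto

text \<open>Scalars become constant Laurent polynomials, so that coordinate identities are settled
  by the laws of a commutative ring.\<close>

lemma laurent_scale_eq_mult:
  fixes f :: "'f::field laurent_poly"
  shows "laurent_scale c f = Poly_Mapping.single 0 c * f"
proof -
  have f: "f = (\<Sum>n\<in>Poly_Mapping.keys f. Poly_Mapping.single n (Poly_Mapping.lookup f n))"
    by (rule poly_mapping_eqI) (simp add: lookup_sum lookup_single when_def in_keys_iff)
  have "Poly_Mapping.single 0 c * f
      = (\<Sum>n\<in>Poly_Mapping.keys f. Poly_Mapping.single n (c * Poly_Mapping.lookup f n))"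
    by (subst f) (simp add: sum_distrib_left mult_single)
  also have "\<dots> = laurent_scale c f"
    by (rule poly_mapping_eqI) (auto simp: lookup_sum lookup_single when_def in_keys_iff)
  finally show ?thesis ..
qed

lemma laurent_mult_linear:
  fixes u :: "'f::field laurent_poly"
  shows "(\<lambda>f. u * f) \<in> linear_maps laurent_scale UNIV laurent_scale UNIV"
  by (simp add: linear_maps_def distrib_left laurent_scale_eq_mult mult.left_commute)

lemma Der_laurent_one: "d \<in> Der_laurent \<Longrightarrow> d 1 = 0" for d :: "'f::field laurent_poly \<Rightarrow> _"
proof -
  assume "d \<in> Der_laurent"
  hence "d (1 * 1) = d 1 * 1 + 1 * d 1" unfolding Der_def by blast
  hence "d 1 = d 1 + d 1" by (simp only: mult_1_left mult_1_right)
  thus "d 1 = 0" unfolding add_cancel_right_right .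
qed

context
  fixes s1 :: "'f::field \<Rightarrow> 'v::ab_group_add \<Rightarrow> 'v" and s2 :: "'f \<Rightarrow> 'w::ab_group_add \<Rightarrow> 'w" and V W \<phi>
  assumes vs: "vector_space s1" "vector_space s2" and V: "module.subspace s1 V"
    and \<phi>: "\<phi> \<in> linear_maps s1 V s2 W"
begin

lemma linear_maps_zero: "\<phi> 0 = 0"
proof -
  interpret vector_space s1 by fact
  have "\<phi> (0 + 0) = \<phi> 0 + \<phi> 0"
    using \<phi> subspace_0[OF V] unfolding linear_maps_def by blast
  thus ?thesis by simp
qed

lemma linear_maps_sum: "(\<And>i. i \<in> I \<Longrightarrow> x i \<in> V) \<Longrightarrow> \<phi> (\<Sum>i\<in>I. x i) = (\<Sum>i\<in>I. \<phi> (x i))"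
proof (induction I rule: infinite_finite_induct)
  case (insert i I)
  interpret vector_space s1 by fact
  have "\<phi> (x i + (\<Sum>i\<in>I. x i)) = \<phi> (x i) + \<phi> (\<Sum>i\<in>I. x i)"
    using \<phi> insert.prems subspace_sum[OF V, of I x] unfolding linear_maps_def by blast
  with insert show ?case by simp
qed (auto simp: linear_maps_zero)

end

lemma subspace_linear_maps:
  fixes s1 :: "'f::field \<Rightarrow> 'v::ab_group_add \<Rightarrow> 'v" and s2 :: "'f \<Rightarrow> 'w::ab_group_add \<Rightarrow> 'w"
  assumes "vector_space s1" "vector_space s2" "module.subspace s2 W"
  shows "module.subspace (fun_scale s2) (linear_maps s1 V s2 W)"
proof -
  interpret W: vector_space s2 by fact
  interpret F: vector_space "fun_scale s2 :: _ \<Rightarrow> ('v \<Rightarrow> _) \<Rightarrow> _" by (rule W.vector_space_fun_scale)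
  show ?thesis
    using W.subspace_0[OF assms(3)] W.subspace_add[OF assms(3)] W.subspace_scale[OF assms(3)]
    by (auto simp: F.subspace_def linear_maps_def fun_scale_def W.scale_right_distrib
        W.scale_left_commute)
qed

context vector_space
begin

text \<open>A Laurent polynomial with coefficients in \<open>L\<close> is the finite sum of its
  monomials, and these are pure tensors; additive properties therefore need to be checked on pure
  tensors only.\<close>

lemma loop_induct [consumes 2, case_names add tensor]:
  assumes L: "subspace L" and p: "p \<in> loop L"
    and add: "\<And>p q. p \<in> loop L \<Longrightarrow> q \<in> loop L \<Longrightarrow> P p \<Longrightarrow> P q \<Longrightarrow> P (p + q)"
    and tensor: "\<And>x f. x \<in> L \<Longrightarrow> P (tensor scale x f)"
  shows "P p"
proof -
  interpret P: vector_space "pm_scale scale" by (rule vector_space_pm_scale)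
  note subP = subspace_loop[OF L]
  have x: "Poly_Mapping.lookup p n \<in> L" for n using p by (simp add: loop_def)
  have t: "tensor scale (Poly_Mapping.lookup p n) f \<in> loop L" for n f
    by (intro tensor_in_loop L x)
  have "tensor scale 0 0 = 0" by (simp add: poly_mapping_eq_iff fun_eq_iff)
  with tensor[OF subspace_0[OF L], of 0] have P0: "P 0" by simp
  have "P (\<Sum>n\<in>K. tensor scale (Poly_Mapping.lookup p n) (Poly_Mapping.single n 1))" for K
    by (induction K rule: infinite_finite_induct)
      (auto intro!: P0 add t tensor x P.subspace_sum[OF subP])
  from this[of "Poly_Mapping.keys p"] show ?thesis by (simp add: loop_eq_sum_tensor[symmetric])
qed

lemma tensor_map_linear:
  assumes L: "subspace L"
    and D: "D \<in> linear_maps scale L scale L"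
    and g: "g \<in> linear_maps laurent_scale UNIV laurent_scale UNIV"
  shows "tensor_map scale L D g \<in> linear_maps (pm_scale scale) (loop L) (pm_scale scale) (loop L)"
proof -
  interpret P: vector_space "pm_scale scale" by (rule vector_space_pm_scale)
  note subP = subspace_loop[OF L]
  let ?F = "\<lambda>n x. tensor scale (D x) (g (Poly_Mapping.single n 1))"
  have D': "D x \<in> L" "D (x + y) = D x + D y" "D (scale c x) = scale c (D x)"
    if "x \<in> L" "y \<in> L" for x y c
    using D that unfolding linear_maps_def by blast+
  have lin: "?F n (x + y) = ?F n x + ?F n y" "?F n (scale c x) = pm_scale scale c (?F n x)"
    if "x \<in> L" "y \<in> L" for x y c n
    using that by (simp_all add: D' tensor_bilinear)
  note sl = sum_keys_linear[where F = ?F, OF vector_space_axioms L vector_space_pm_scale lin]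
  show ?thesis
    using sl P.subspace_add[OF subP] P.subspace_scale[OF subP]
    by (auto simp: linear_maps_def tensor_map_def loop_def[symmetric]
        intro!: P.subspace_sum[OF subP] tensor_in_loop L D' L)
      (auto simp: loop_def)
qed

end

section \<open>Derivations of loop algebras\<close>

context lie_algebra
begin

lemma br_zero [simp]: "br 0 x = 0" "br x 0 = 0"
  using br_scale_left[of 0 0 x] br_scale_right[of x 0 0] by auto

lemma br_skew: "br x y = - br y x"
proof -
  have "br x y + br y x = 0"
    using br_self[of "x + y"] unfolding br_add_left br_add_right by (simp add: br_self add.commute)
  thus ?thesis by (simp add: eq_neg_iff_add_eq_0)
qed

lemma br_sum_left: "br (\<Sum>i\<in>I. x i) y = (\<Sum>i\<in>I. br (x i) y)"
  by (induction I rule: infinite_finite_induct) (auto simp: br_add_left)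

lemma br_sum_right: "br x (\<Sum>i\<in>I. y i) = (\<Sum>i\<in>I. br x (y i))"
  by (induction I rule: infinite_finite_induct) (auto simp: br_add_right)

text \<open>Supports can shrink under addition and scaling. Summing over larger finite sets gives
  all brackets in a bilinearity identity the same index set.\<close>

lemma loop_br_eq_sum:
  assumes "finite K" "Poly_Mapping.keys p \<subseteq> K" "finite K'" "Poly_Mapping.keys q \<subseteq> K'"
  shows "loop_br br p q = (\<Sum>m\<in>K. \<Sum>n\<in>K'.
     Poly_Mapping.single (m + n) (br (Poly_Mapping.lookup p m) (Poly_Mapping.lookup q n)))"
  unfolding loop_br_def
  by (subst sum_keys_mono[OF assms(1,2)], simp, intro sum.cong refl sum_keys_mono)
    (use assms in auto)

lemma loop_br_add_left: "loop_br br (p + p') q = loop_br br p q + loop_br br p' q"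
  by (subst (1 2 3) loop_br_eq_sum[where K = "Poly_Mapping.keys p \<union> Poly_Mapping.keys p'"
        and K' = "Poly_Mapping.keys q"])
    (use keys_add[of p p'] in \<open>auto simp: lookup_add br_add_left single_add sum.distrib\<close>)

lemma loop_br_add_right: "loop_br br q (p + p') = loop_br br q p + loop_br br q p'"
  by (subst (1 2 3) loop_br_eq_sum[where K' = "Poly_Mapping.keys p \<union> Poly_Mapping.keys p'"
        and K = "Poly_Mapping.keys q"])
    (use keys_add[of p p'] in \<open>auto simp: lookup_add br_add_right single_add sum.distrib\<close>)

lemma loop_br_scale_left: "loop_br br (pm_scale scale c p) q = pm_scale scale c (loop_br br p q)"
proof -
  have "Poly_Mapping.keys (pm_scale scale c p) \<subseteq> Poly_Mapping.keys p"
    by (auto simp: in_keys_iff)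
  thus ?thesis
    by (subst (1 2) loop_br_eq_sum[where K = "Poly_Mapping.keys p" and K' = "Poly_Mapping.keys q"])
      (auto intro!: poly_mapping_eqI sum.cong
        simp: lookup_sum lookup_single when_def br_scale_left scale_sum_right)
qed

lemma loop_br_scale_right: "loop_br br p (pm_scale scale c q) = pm_scale scale c (loop_br br p q)"
proof -
  have "Poly_Mapping.keys (pm_scale scale c q) \<subseteq> Poly_Mapping.keys q"
    by (auto simp: in_keys_iff)
  thus ?thesis
    by (subst (1 2) loop_br_eq_sum[where K = "Poly_Mapping.keys p" and K' = "Poly_Mapping.keys q"])
      (auto intro!: poly_mapping_eqI sum.cong
        simp: lookup_sum lookup_single when_def br_scale_right scale_sum_right)
qed

lemma loop_br_closed:
  assumes "subalgebra scale br L" "p \<in> loop L" "q \<in> loop L"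
  shows "loop_br br p q \<in> loop L"
proof -
  have L: "subspace L" and br: "\<And>x y. x \<in> L \<Longrightarrow> y \<in> L \<Longrightarrow> br x y \<in> L"
    using assms(1) by (auto simp: subalgebra_def)
  show ?thesis
    using assms(2,3)
    by (auto intro!: subspace_sum[OF L] br subspace_0[OF L]
        simp: loop_def loop_br_def lookup_sum lookup_single when_def)
qed

section \<open>The two summands: they consist of derivations and intersect trivially\<close>

lemma subspace_Der_loop:
  assumes "subspace L"
  shows "module.subspace (fun_scale (pm_scale scale)) (Der (pm_scale scale) (loop_br br) (loop L))"
proof -
  interpret P: vector_space "pm_scale scale" by (rule vector_space_pm_scale)
  interpret F: vector_space "fun_scale (pm_scale scale) :: _ \<Rightarrow> ((int \<Rightarrow>\<^sub>0 'a) \<Rightarrow> _) \<Rightarrow> _"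
    by (rule P.vector_space_fun_scale)
  have "P.subspace (loop L)" by (rule subspace_loop) fact
  from subspace_linear_maps[OF P.vector_space_axioms P.vector_space_axioms this, of "loop L"]
  show ?thesis
    unfolding F.subspace_def Der_def
    by (auto simp: fun_scale_def loop_br_add_left loop_br_add_right loop_br_scale_left
        loop_br_scale_right P.scale_right_distrib algebra_simps loop_br_scale_left[of 0, simplified]
        loop_br_scale_right[of _ 0, simplified])
qed

text \<open>Both sides of the Leibniz rule are additive in each argument, so pure tensors
  suffice.\<close>

lemma loop_DerI:
  assumes "subalgebra scale br L"
    and T: "T \<in> linear_maps (pm_scale scale) (loop L) (pm_scale scale) (loop L)"
    and br: "\<And>x y f g. x \<in> L \<Longrightarrow> y \<in> L \<Longrightarrow> T (tensor scale (br x y) (f * g))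
      = loop_br br (T (tensor scale x f)) (tensor scale y g)
      + loop_br br (tensor scale x f) (T (tensor scale y g))"
  shows "T \<in> Der (pm_scale scale) (loop_br br) (loop L)"
proof -
  have L: "subspace L" using assms(1) by (simp add: subalgebra_def)
  have T_add: "T (p + q) = T p + T q" if "p \<in> loop L" "q \<in> loop L" for p q
    using T that unfolding linear_maps_def by blast
  note simps = T_add loop_br_add_left loop_br_add_right loop_br_closed[OF assms(1)]
    tensor_in_loop[OF L] add_ac
  have "T (loop_br br p q) = loop_br br (T p) q + loop_br br p (T q)"
    if "p \<in> loop L" and q: "q \<in> loop L" for p q
    using L that(1)
  proof (induction p rule: loop_induct)
    case (tensor x f)
    from L q show ?case
    proof (induction q rule: loop_induct)
      case (tensor y g)
      show ?case using br[OF \<open>x \<in> L\<close> tensor] by (simp add: loop_br_tensor)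
    qed (use \<open>x \<in> L\<close> in \<open>simp add: simps\<close>)
  qed (use q in \<open>simp add: simps\<close>)
  with T show ?thesis by (simp add: Der_def)
qed

text \<open>For a generator D \<otimes> u all three terms of the Leibniz rule carry the same factor
  u f g, because S is commutative; what remains is the rule for D.\<close>

lemma Der_tensor_laurent_subset:
  assumes "subalgebra scale br L"
  shows "Der_tensor_laurent scale br L \<subseteq> Der (pm_scale scale) (loop_br br) (loop L)"
proof -
  interpret P: vector_space "pm_scale scale" by (rule vector_space_pm_scale)
  interpret F: vector_space "fun_scale (pm_scale scale) :: _ \<Rightarrow> ((int \<Rightarrow>\<^sub>0 'a) \<Rightarrow> _) \<Rightarrow> _"
    by (rule P.vector_space_fun_scale)
  have L: "subspace L" using assms(1) by (simp add: subalgebra_def)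
  have "tensor_map scale L D (\<lambda>f. u * f) \<in> Der (pm_scale scale) (loop_br br) (loop L)"
    if D: "D \<in> Der scale br L" for D u
  proof (rule loop_DerI[OF assms])
    have lin: "D \<in> linear_maps scale L scale L" using D by (simp add: Der_def)
    show "tensor_map scale L D (\<lambda>f. u * f)
        \<in> linear_maps (pm_scale scale) (loop L) (pm_scale scale) (loop L)"
      by (rule tensor_map_linear[OF L lin laurent_mult_linear])
    fix x y and f g :: "'f laurent_poly" assume xy: "x \<in> L" "y \<in> L"
    have "br x y \<in> L" using assms xy by (auto simp: subalgebra_def)
    moreover have "D (br x y) = br (D x) y + br x (D y)" using D xy by (auto simp: Der_def)
    moreover have T: "tensor_map scale L D (\<lambda>f. u * f) (tensor scale x f) = tensor scale (D x) (u * f)"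
      if "x \<in> L" for x f
      by (rule tensor_map_tensor[OF vector_space_axioms L lin laurent_mult_linear that])
    ultimately show "tensor_map scale L D (\<lambda>f. u * f) (tensor scale (br x y) (f * g))
      = loop_br br (tensor_map scale L D (\<lambda>f. u * f) (tensor scale x f)) (tensor scale y g)
      + loop_br br (tensor scale x f) (tensor_map scale L D (\<lambda>f. u * f) (tensor scale y g))"
      by (simp only: T xy loop_br_tensor tensor_bilinear mult.assoc mult.left_commute[of f u])
  qed
  thus ?thesis
    unfolding Der_tensor_laurent_def by (intro F.span_minimal subspace_Der_loop[OF L]) auto
qed

text \<open>The rule for d splits d (f g) into two terms, and the centroid property lets \<phi> act
  in each term on the argument whose Laurent factor is differentiated.\<close>

lemma Cent_tensor_Der_laurent_subset:
  assumes "subalgebra scale br L"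
  shows "Cent_tensor_Der_laurent scale br L \<subseteq> Der (pm_scale scale) (loop_br br) (loop L)"
proof -
  interpret P: vector_space "pm_scale scale" by (rule vector_space_pm_scale)
  interpret F: vector_space "fun_scale (pm_scale scale) :: _ \<Rightarrow> ((int \<Rightarrow>\<^sub>0 'a) \<Rightarrow> _) \<Rightarrow> _"
    by (rule P.vector_space_fun_scale)
  have L: "subspace L" using assms(1) by (simp add: subalgebra_def)
  have "tensor_map scale L \<phi> d \<in> Der (pm_scale scale) (loop_br br) (loop L)"
    if \<phi>: "\<phi> \<in> Cent scale br L" and d: "d \<in> Der_laurent" for \<phi> d
  proof (rule loop_DerI[OF assms])
    have lin: "\<phi> \<in> linear_maps scale L scale L" using \<phi> by (simp add: Cent_def)
    have lind: "d \<in> linear_maps laurent_scale UNIV laurent_scale UNIV" using d by (simp add: Der_def)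
    show "tensor_map scale L \<phi> d
        \<in> linear_maps (pm_scale scale) (loop L) (pm_scale scale) (loop L)"
      by (rule tensor_map_linear[OF L lin lind])
    fix x y and f g :: "'f laurent_poly" assume xy: "x \<in> L" "y \<in> L"
    have "br x y \<in> L" using assms xy by (auto simp: subalgebra_def)
    moreover have "\<phi> (br x y) = br (\<phi> x) y" "\<phi> (br x y) = br x (\<phi> y)"
      using \<phi> xy unfolding Cent_def by blast+
    moreover have "d (f * g) = d f * g + f * d g" using d by (auto simp: Der_def)
    moreover have T: "tensor_map scale L \<phi> d (tensor scale x f) = tensor scale (\<phi> x) (d f)"
      if "x \<in> L" for x f
      by (rule tensor_map_tensor[OF vector_space_axioms L lin lind that])
    ultimately show "tensor_map scale L \<phi> d (tensor scale (br x y) (f * g))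
      = loop_br br (tensor_map scale L \<phi> d (tensor scale x f)) (tensor scale y g)
      + loop_br br (tensor scale x f) (tensor_map scale L \<phi> d (tensor scale y g))"
      by (metis (no_types, lifting) xy loop_br_tensor tensor_bilinear(3))
  qed
  thus ?thesis
    unfolding Cent_tensor_Der_laurent_def by (intro F.span_minimal subspace_Der_loop[OF L]) auto
qed

text \<open>Derivations of S vanish at 1. This property separates the second summand from the
  first.\<close>

lemma Cent_tensor_Der_laurent_kills_constants:
  assumes L: "subspace L" and A: "A \<in> Cent_tensor_Der_laurent scale br L" and x: "x \<in> L"
  shows "A (tensor scale x 1) = 0"
proof -
  interpret P: vector_space "pm_scale scale" by (rule vector_space_pm_scale)
  interpret F: vector_space "fun_scale (pm_scale scale) :: _ \<Rightarrow> ((int \<Rightarrow>\<^sub>0 'a) \<Rightarrow> _) \<Rightarrow> _"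
    by (rule P.vector_space_fun_scale)
  have "Cent_tensor_Der_laurent scale br L \<subseteq> {A. A (tensor scale x 1) = 0}"
    unfolding Cent_tensor_Der_laurent_def
  proof (rule F.span_minimal; (rule subsetI)?)
    show "F.subspace {A. A (tensor scale x 1) = 0}"
      by (auto simp: F.subspace_def fun_scale_def)
    fix T assume "T \<in> {tensor_map scale L \<phi> d |\<phi> d. \<phi> \<in> Cent scale br L \<and> d \<in> Der_laurent}"
    then obtain \<phi> d where T: "T = tensor_map scale L \<phi> d" "\<phi> \<in> Cent scale br L" "d \<in> Der_laurent"
      by auto
    have "T (tensor scale x 1) = tensor scale (\<phi> x) (d 1)"
      unfolding T by (rule tensor_map_tensor[OF vector_space_axioms L])
        (use T x in \<open>auto simp: Cent_def Der_def\<close>)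
    thus "T \<in> {A. A (tensor scale x 1) = 0}"
      using Der_laurent_one[OF T(3)] by (simp add: poly_mapping_eq_iff fun_eq_iff)
  qed
  thus ?thesis using A by auto
qed

text \<open>Elements of \<open>Der L \<otimes> S\<close> are \<open>S\<close>-linear; for monomials this says that they commute with shifts
  of the exponent.\<close>

lemma Der_tensor_laurent_shift:
  assumes L: "subspace L" and A: "A \<in> Der_tensor_laurent scale br L" and x: "x \<in> L"
  shows "Poly_Mapping.lookup (A (tensor scale x (Poly_Mapping.single m 1))) (m + n)
       = Poly_Mapping.lookup (A (tensor scale x 1)) n"
proof -
  interpret P: vector_space "pm_scale scale" by (rule vector_space_pm_scale)
  interpret F: vector_space "fun_scale (pm_scale scale) :: _ \<Rightarrow> ((int \<Rightarrow>\<^sub>0 'a) \<Rightarrow> _) \<Rightarrow> _"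
    by (rule P.vector_space_fun_scale)
  let ?S = "{A. Poly_Mapping.lookup (A (tensor scale x (Poly_Mapping.single m 1))) (m + n)
       = Poly_Mapping.lookup (A (tensor scale x 1)) n}"
  \<comment> \<open>Multiplication by the monomial of exponent \<open>m\<close> translates
    coefficients by \<open>m\<close>.\<close>
  have sh: "Poly_Mapping.lookup (u * Poly_Mapping.single m 1) (m + n) = Poly_Mapping.lookup u n"
    for u :: "'f laurent_poly"
  proof -
    have "u = (\<Sum>n\<in>Poly_Mapping.keys u. Poly_Mapping.single n (Poly_Mapping.lookup u n))"
      by (rule poly_mapping_eqI) (simp add: lookup_sum lookup_single when_def in_keys_iff)
    hence "u * Poly_Mapping.single m 1
        = (\<Sum>n\<in>Poly_Mapping.keys u. Poly_Mapping.single n (Poly_Mapping.lookup u n))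
          * Poly_Mapping.single m 1" by simp
    thus ?thesis
      by (simp add: sum_distrib_right mult_single lookup_sum lookup_single when_def in_keys_iff
          add.commute[of _ m])
  qed
  have "Der_tensor_laurent scale br L \<subseteq> ?S"
    unfolding Der_tensor_laurent_def
  proof (rule F.span_minimal; (rule subsetI)?)
    show "F.subspace ?S"
      by (auto simp: F.subspace_def fun_scale_def lookup_add)
    fix T assume "T \<in> {tensor_map scale L D (\<lambda>f. u * f) |D u. D \<in> Der scale br L}"
    then obtain D u where T: "T = tensor_map scale L D (\<lambda>f. u * f)" "D \<in> Der scale br L"
      by auto
    have "T (tensor scale x f) = tensor scale (D x) (u * f)" for f
      unfolding T by (rule tensor_map_tensor[OF vector_space_axioms L _ laurent_mult_linear])
        (use T x in \<open>auto simp: Der_def\<close>)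
    thus "T \<in> ?S" by (simp add: sh)
  qed
  thus ?thesis using A by auto
qed

text \<open>A map in both spaces vanishes on every x \<otimes> 1 and commutes with shifts of the
  exponent, so it vanishes on every monomial.\<close>

lemma Der_tensor_laurent_Int_Cent_tensor_Der_laurent:
  assumes "subalgebra scale br L"
  shows "Der_tensor_laurent scale br L \<inter> Cent_tensor_Der_laurent scale br L = {0}"
proof -
  interpret P: vector_space "pm_scale scale" by (rule vector_space_pm_scale)
  interpret F: vector_space "fun_scale (pm_scale scale) :: _ \<Rightarrow> ((int \<Rightarrow>\<^sub>0 'a) \<Rightarrow> _) \<Rightarrow> _"
    by (rule P.vector_space_fun_scale)
  have L: "subspace L" using assms(1) by (simp add: subalgebra_def)
  have "A = 0" if A: "A \<in> Der_tensor_laurent scale br L" "A \<in> Cent_tensor_Der_laurent scale br L" for A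
  proof
    have lin: "A \<in> linear_maps (pm_scale scale) (loop L) (pm_scale scale) (loop L)"
      using A(1) Der_tensor_laurent_subset[OF assms] by (auto simp: Der_def)
    fix p
    show "A p = 0 p"
    proof (cases "p \<in> loop L")
      case True
      have "A (tensor scale (Poly_Mapping.lookup p m) (Poly_Mapping.single m 1)) = 0" for m
      proof (rule poly_mapping_eqI)
        fix n
        have x: "Poly_Mapping.lookup p m \<in> L" using True by (simp add: loop_def)
        show "Poly_Mapping.lookup (A (tensor scale (Poly_Mapping.lookup p m) (Poly_Mapping.single m 1))) n
            = Poly_Mapping.lookup 0 n"
          using Der_tensor_laurent_shift[OF L A(1) x, of m "n - m"]
            Cent_tensor_Der_laurent_kills_constants[OF L A(2) x] by simp
      qed
      moreover have "A (\<Sum>m\<in>Poly_Mapping.keys p. tensor scale (Poly_Mapping.lookup p m) (Poly_Mapping.single m 1))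
          = (\<Sum>m\<in>Poly_Mapping.keys p. A (tensor scale (Poly_Mapping.lookup p m) (Poly_Mapping.single m 1)))"
        by (rule linear_maps_sum[OF P.vector_space_axioms P.vector_space_axioms subspace_loop[OF L] lin])
          (use True in \<open>auto simp: loop_def intro: subspace_scale[OF L]\<close>)
      ultimately show ?thesis by (simp add: loop_eq_sum_tensor[symmetric])
    qed (use lin in \<open>simp add: linear_maps_def\<close>)
  qed
  thus ?thesis
    unfolding Der_tensor_laurent_def Cent_tensor_Der_laurent_def
    by (auto intro: F.span_zero)
qed

end

section \<open>Direct sums of two-dimensional nonabelian Lie algebras\<close>

text \<open>Each pair \<open>h i\<close>, \<open>e i\<close> spans a copy of the Lie algebra of the
  affine group of the line. Linear independence of all these vectors is a consequence of the
  relations: bracketing a linear relation with \<open>e i\<close> or \<open>h i\<close> isolates a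
  single coefficient.\<close>

locale sum_of_affine_algebras = lie_algebra scale br
  for scale :: "'f::field \<Rightarrow> 'a::ab_group_add \<Rightarrow> 'a" (infixr \<open>*s\<close> 75) and br +
  fixes I :: "'i set" and h e :: "'i \<Rightarrow> 'a" and L :: "'a set"
  assumes finite_I: "finite I"
    and L_eq: "L = span (h ` I \<union> e ` I)"
    and e_nonzero: "i \<in> I \<Longrightarrow> e i \<noteq> 0"
    and br_h_h: "i \<in> I \<Longrightarrow> j \<in> I \<Longrightarrow> br (h i) (h j) = 0"
    and br_h_e: "i \<in> I \<Longrightarrow> j \<in> I \<Longrightarrow> br (h i) (e j) = (if i = j then e j else 0)"
    and br_e_e: "i \<in> I \<Longrightarrow> j \<in> I \<Longrightarrow> br (e i) (e j) = 0"
begin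

text \<open>The coordinates with respect to the basis \<open>h i, e i\<close> can be read off from the brackets
  with \<open>e i\<close> and \<open>h i\<close>.\<close>

definition h_coord :: "'i \<Rightarrow> 'a \<Rightarrow> 'f" where
  "h_coord i x = (if x \<in> L then THE c. br x (e i) = c *s e i else 0)"

definition e_coord :: "'i \<Rightarrow> 'a \<Rightarrow> 'f" where
  "e_coord i x = (if x \<in> L then THE c. br (h i) x = c *s e i else 0)"

lemma subspace_L: "subspace L"
  unfolding L_eq by (rule subspace_span)

lemma h_in_L: "i \<in> I \<Longrightarrow> h i \<in> L" and e_in_L: "i \<in> I \<Longrightarrow> e i \<in> L"
  unfolding L_eq by (auto intro: span_base)

lemmas L_closed = subspace_add[OF subspace_L] subspace_scale[OF subspace_L] h_in_L e_in_L

lemma coord_outside [simp]: "x \<notin> L \<Longrightarrow> h_coord i x = 0" "x \<notin> L \<Longrightarrow> e_coord i x = 0"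
  by (simp_all add: h_coord_def e_coord_def)

lemma h_coord_unique: "x \<in> L \<Longrightarrow> i \<in> I \<Longrightarrow> br x (e i) = c *s e i \<Longrightarrow> h_coord i x = c"
  by (auto simp: h_coord_def e_nonzero)

lemma e_coord_unique: "x \<in> L \<Longrightarrow> i \<in> I \<Longrightarrow> br (h i) x = c *s e i \<Longrightarrow> e_coord i x = c"
  by (auto simp: e_coord_def e_nonzero)

lemma L_expansion_exists:
  assumes "x \<in> L"
  obtains a b where "x = (\<Sum>i\<in>I. a i *s h i + b i *s e i)"
proof -
  let ?C = "{x. \<exists>a b. x = (\<Sum>i\<in>I. a i *s h i + b i *s e i)}"
  have "L \<subseteq> ?C"
    unfolding L_eq
  proof (rule span_minimal)
    show "h ` I \<union> e ` I \<subseteq> ?C"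
    proof safe
      fix i assume "i \<in> I"
      hence "h i = (\<Sum>j\<in>I. (if j = i then 1 else 0) *s h j + 0 *s e j)"
        and "e i = (\<Sum>j\<in>I. 0 *s h j + (if j = i then 1 else 0) *s e j)"
        using finite_I by (simp_all add: if_distrib[of "\<lambda>c. c *s _"] cong: if_cong)
      thus "\<exists>a b. h i = (\<Sum>i\<in>I. a i *s h i + b i *s e i)"
        and "\<exists>a b. e i = (\<Sum>i\<in>I. a i *s h i + b i *s e i)" by fast+
    qed
    show "subspace ?C"
    proof (rule subspaceI)
      show "0 \<in> ?C" by (auto intro!: exI[of _ "\<lambda>_. 0"])
      fix x y assume "x \<in> ?C" "y \<in> ?C"
      then obtain a b a' b' where "x = (\<Sum>i\<in>I. a i *s h i + b i *s e i)"
        "y = (\<Sum>i\<in>I. a' i *s h i + b' i *s e i)" by blast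
      hence "x + y = (\<Sum>i\<in>I. (a i + a' i) *s h i + (b i + b' i) *s e i)"
        by (simp add: sum.distrib scale_left_distrib)
      thus "x + y \<in> ?C" by fast
    next
      fix c x assume "x \<in> ?C"
      then obtain a b where "x = (\<Sum>i\<in>I. a i *s h i + b i *s e i)" by blast
      hence "c *s x = (\<Sum>i\<in>I. (c * a i) *s h i + (c * b i) *s e i)"
        by (simp add: scale_sum_right scale_right_distrib)
      thus "c *s x \<in> ?C" by fast
    qed
  qed
  with assms that show thesis by blast
qed

text \<open>Bracketing an arbitrary expansion of \<open>x\<close> with \<open>e i\<close> or
  \<open>h i\<close> leaves one term. Its coefficient is therefore the corresponding coordinate,
  which also identifies the expansion.\<close>

lemma
  assumes "x \<in> L"
  shows br_e_right: "i \<in> I \<Longrightarrow> br x (e i) = h_coord i x *s e i"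
    and br_h_left: "i \<in> I \<Longrightarrow> br (h i) x = e_coord i x *s e i"
    and L_expansion: "x = (\<Sum>i\<in>I. h_coord i x *s h i + e_coord i x *s e i)"
proof -
  from L_expansion_exists[OF assms] obtain a b
    where x: "x = (\<Sum>i\<in>I. a i *s h i + b i *s e i)" .
  have a: "br x (e i) = a i *s e i" and b: "br (h i) x = b i *s e i" if "i \<in> I" for i
    using that finite_I
    by (simp_all add: x br_sum_left br_sum_right br_add_left br_add_right br_scale_left
        br_scale_right br_h_h br_h_e br_e_e if_distrib[of "\<lambda>y. _ *s y"] cong: if_cong)
  have eq: "h_coord i x = a i" "e_coord i x = b i" if "i \<in> I" for i
    using that assms by (auto intro: h_coord_unique e_coord_unique a b)
  show "i \<in> I \<Longrightarrow> br x (e i) = h_coord i x *s e i" "i \<in> I \<Longrightarrow> br (h i) x = e_coord i x *s e i"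
    by (simp_all add: a b eq)
  show "x = (\<Sum>i\<in>I. h_coord i x *s h i + e_coord i x *s e i)"
    by (subst x) (simp add: eq)
qed

lemma br_e_left: "x \<in> L \<Longrightarrow> i \<in> I \<Longrightarrow> br (e i) x = (- h_coord i x) *s e i"
  by (subst br_skew) (simp add: br_e_right)

lemma coord_add [simp]:
  assumes "x \<in> L" "y \<in> L" "i \<in> I"
  shows "h_coord i (x + y) = h_coord i x + h_coord i y" "e_coord i (x + y) = e_coord i x + e_coord i y"
  using assms by (auto intro!: h_coord_unique e_coord_unique L_closed
      simp: br_add_left br_add_right br_e_right br_h_left scale_left_distrib)

lemma coord_scale [simp]:
  assumes "x \<in> L" "i \<in> I"
  shows "h_coord i (c *s x) = c * h_coord i x" "e_coord i (c *s x) = c * e_coord i x"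
  using assms by (auto intro!: h_coord_unique e_coord_unique L_closed
      simp: br_scale_left br_scale_right br_e_right br_h_left)

lemma coord_h [simp]:
  assumes "i \<in> I" "j \<in> I"
  shows "h_coord j (h i) = (if i = j then 1 else 0)" "e_coord j (h i) = 0"
  using assms by (auto intro!: h_coord_unique e_coord_unique L_closed simp: br_h_e br_h_h)

lemma coord_e [simp]:
  assumes "i \<in> I" "j \<in> I"
  shows "e_coord j (e i) = (if i = j then 1 else 0)" "h_coord j (e i) = 0"
  using assms by (auto intro!: h_coord_unique e_coord_unique L_closed simp: br_h_e br_e_e)

lemma coord_zero [simp]: "i \<in> I \<Longrightarrow> h_coord i 0 = 0" "i \<in> I \<Longrightarrow> e_coord i 0 = 0"
  by (auto intro!: h_coord_unique e_coord_unique subspace_0[OF subspace_L])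

lemma br_expansion:
  assumes "x \<in> L" "y \<in> L"
  shows "br x y = (\<Sum>i\<in>I. (h_coord i x * e_coord i y - e_coord i x * h_coord i y) *s e i)"
proof -
  have "br x y = br (\<Sum>i\<in>I. h_coord i x *s h i + e_coord i x *s e i) y"
    using L_expansion[OF assms(1)] by simp
  thus ?thesis
    using assms(2) by (simp add: br_sum_left br_add_left br_scale_left br_h_left br_e_left
        scale_left_diff_distrib)
qed

lemma subalgebra_L: "subalgebra scale br L"
  unfolding subalgebra_def
  by (auto simp: br_expansion subspace_L intro!: subspace_sum[OF subspace_L] L_closed)

lemma coord_sum_e:
  assumes "j \<in> I"
  shows "h_coord j (\<Sum>i\<in>I. c i *s e i) = 0" "e_coord j (\<Sum>i\<in>I. c i *s e i) = c j"
proof -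
  have "(\<Sum>i\<in>I. c i *s e i) \<in> L" by (auto intro!: subspace_sum[OF subspace_L] L_closed)
  thus "h_coord j (\<Sum>i\<in>I. c i *s e i) = 0" "e_coord j (\<Sum>i\<in>I. c i *s e i) = c j"
    using assms finite_I
    by (auto intro!: h_coord_unique e_coord_unique simp: br_sum_left br_sum_right br_scale_left
        br_scale_right br_e_e br_h_e if_distrib[of "\<lambda>y. _ *s y"] cong: if_cong)
qed

lemma coord_br:
  assumes "x \<in> L" "y \<in> L" "i \<in> I"
  shows "h_coord i (br x y) = 0"
    and "e_coord i (br x y) = h_coord i x * e_coord i y - e_coord i x * h_coord i y"
  using assms by (simp_all add: br_expansion coord_sum_e)

text \<open>The projection to the \<open>i\<close>-th summand is in the centroid; the other two maps are the
  inner derivations given by \<open>h i\<close> and \<open>-e i\<close>.\<close>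

definition proj where "proj i x = h_coord i x *s h i + e_coord i x *s e i"
definition ad_h where "ad_h i x = e_coord i x *s e i"
definition ad_neg_e where "ad_neg_e i x = h_coord i x *s e i"

lemma summand_maps_linear:
  assumes "i \<in> I"
  shows "proj i \<in> linear_maps scale L scale L" "ad_h i \<in> linear_maps scale L scale L"
    "ad_neg_e i \<in> linear_maps scale L scale L"
  using assms by (auto simp: linear_maps_def proj_def ad_h_def ad_neg_e_def L_closed
      scale_left_distrib scale_right_distrib)

lemma summand_maps_generators [simp]:
  assumes "i \<in> I" "j \<in> I"
  shows "proj j (h i) = (if i = j then h i else 0)" "proj j (e i) = (if i = j then e i else 0)"
    "ad_h j (h i) = 0" "ad_h j (e i) = (if i = j then e i else 0)"
    "ad_neg_e j (h i) = (if i = j then e i else 0)" "ad_neg_e j (e i) = 0"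
  using assms by (simp_all add: proj_def ad_h_def ad_neg_e_def)

text \<open>The summands are ideals with zero mutual brackets, so the i-th component of a bracket
  depends only on the i-th component of either argument.\<close>

lemma proj_in_Cent: "i \<in> I \<Longrightarrow> proj i \<in> Cent scale br L"
  by (auto simp: Cent_def summand_maps_linear)
    (simp_all add: proj_def coord_br br_add_left br_add_right br_scale_left br_scale_right
      br_h_left br_e_left br_e_right br_skew[of _ "h i"] algebra_simps flip: scale_left_distrib)

lemma ad_h_in_Der: "i \<in> I \<Longrightarrow> ad_h i \<in> Der scale br L"
  by (auto simp: Der_def summand_maps_linear)
    (simp add: ad_h_def coord_br br_scale_left br_scale_right br_e_left br_e_right algebra_simps
      flip: scale_left_distrib)

lemma ad_neg_e_in_Der: "i \<in> I \<Longrightarrow> ad_neg_e i \<in> Der scale br L"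
  by (auto simp: Der_def summand_maps_linear)
    (simp add: ad_neg_e_def coord_br br_scale_left br_scale_right br_e_left br_e_right algebra_simps
      flip: scale_left_distrib)

section \<open>Loop algebras of direct sums of two-dimensional nonabelian Lie algebras\<close>

text \<open>For \<open>i\<close> in \<open>I\<close>, \<open>h_loop i\<close> and
  \<open>e_loop i\<close> are coordinates of the loop algebra as a free S-module with basis h_i
  \<otimes> 1, e_i \<otimes> 1.\<close>

definition h_loop :: "'i \<Rightarrow> (int \<Rightarrow>\<^sub>0 'a) \<Rightarrow> 'f laurent_poly" where
  "h_loop i p = Poly_Mapping.map (h_coord i) p"

definition e_loop :: "'i \<Rightarrow> (int \<Rightarrow>\<^sub>0 'a) \<Rightarrow> 'f laurent_poly" where
  "e_loop i p = Poly_Mapping.map (e_coord i) p"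

lemma lookup_loop_coord [simp]:
  assumes "i \<in> I"
  shows "Poly_Mapping.lookup (h_loop i p) n = h_coord i (Poly_Mapping.lookup p n)"
    "Poly_Mapping.lookup (e_loop i p) n = e_coord i (Poly_Mapping.lookup p n)"
  using assms by (auto simp: h_loop_def e_loop_def Poly_Mapping.map.rep_eq when_def)

lemma loop_coord_add [simp]:
  assumes "i \<in> I" "p \<in> loop L" "q \<in> loop L"
  shows "h_loop i (p + q) = h_loop i p + h_loop i q" "e_loop i (p + q) = e_loop i p + e_loop i q"
  using assms by (auto intro!: poly_mapping_eqI simp: lookup_add loop_def)

lemma loop_coord_scale [simp]:
  assumes "i \<in> I" "p \<in> loop L"
  shows "h_loop i (pm_scale scale c p) = laurent_scale c (h_loop i p)"
    "e_loop i (pm_scale scale c p) = laurent_scale c (e_loop i p)"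
  using assms by (auto intro!: poly_mapping_eqI simp: loop_def)

lemma loop_coord_tensor [simp]:
  assumes "i \<in> I" "x \<in> L"
  shows "h_loop i (tensor scale x f) = Poly_Mapping.single 0 (h_coord i x) * f"
    "e_loop i (tensor scale x f) = Poly_Mapping.single 0 (e_coord i x) * f"
  using assms unfolding laurent_scale_eq_mult[symmetric]
  by (auto intro!: poly_mapping_eqI simp: mult.commute)

lemma loop_coord_zero [simp]: "i \<in> I \<Longrightarrow> h_loop i 0 = 0" "i \<in> I \<Longrightarrow> e_loop i 0 = 0"
  by (auto intro!: poly_mapping_eqI)

lemma loop_eqI:
  assumes "p \<in> loop L" "q \<in> loop L"
    and "\<And>i. i \<in> I \<Longrightarrow> h_loop i p = h_loop i q" "\<And>i. i \<in> I \<Longrightarrow> e_loop i p = e_loop i q"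
  shows "p = q"
proof (rule poly_mapping_eqI)
  fix n
  have "h_coord i (Poly_Mapping.lookup p n) = h_coord i (Poly_Mapping.lookup q n)"
    "e_coord i (Poly_Mapping.lookup p n) = e_coord i (Poly_Mapping.lookup q n)" if "i \<in> I" for i
    using assms(3,4)[OF that] that by (metis lookup_loop_coord)+
  moreover have "Poly_Mapping.lookup p n \<in> L" "Poly_Mapping.lookup q n \<in> L"
    using assms(1,2) by (auto simp: loop_def)
  ultimately show "Poly_Mapping.lookup p n = Poly_Mapping.lookup q n"
    by (subst (1 2) L_expansion) simp_all
qed

lemma h_in_loop [simp]: "i \<in> I \<Longrightarrow> tensor scale (h i) f \<in> loop L"
  and e_in_loop [simp]: "i \<in> I \<Longrightarrow> tensor scale (e i) f \<in> loop L"
  by (auto intro!: tensor_in_loop subspace_L L_closed)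

lemma add_in_loop: "p \<in> loop L \<Longrightarrow> q \<in> loop L \<Longrightarrow> p + q \<in> loop L"
  by (auto simp: loop_def lookup_add L_closed)

lemma loop_coord_sum:
  assumes "i \<in> I" "\<And>j. j \<in> J \<Longrightarrow> p j \<in> loop L"
  shows "h_loop i (\<Sum>j\<in>J. p j) = (\<Sum>j\<in>J. h_loop i (p j))"
    and "e_loop i (\<Sum>j\<in>J. p j) = (\<Sum>j\<in>J. e_loop i (p j))"
proof -
  interpret P: vector_space "pm_scale scale" by (rule vector_space_pm_scale)
  have "(\<Sum>j\<in>J. p j) \<in> loop L \<and> h_loop i (\<Sum>j\<in>J. p j) = (\<Sum>j\<in>J. h_loop i (p j))
      \<and> e_loop i (\<Sum>j\<in>J. p j) = (\<Sum>j\<in>J. e_loop i (p j))"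
    using assms(2)
    by (induction J rule: infinite_finite_induct)
      (use assms(1) P.subspace_0[OF subspace_loop[OF subspace_L]] in \<open>auto intro!: add_in_loop\<close>)
  thus "h_loop i (\<Sum>j\<in>J. p j) = (\<Sum>j\<in>J. h_loop i (p j))"
    "e_loop i (\<Sum>j\<in>J. p j) = (\<Sum>j\<in>J. e_loop i (p j))" by blast+
qed

text \<open>The case of 0 is listed separately because \<open>I\<close> may be empty, and then no
  generator is available to produce it.\<close>

lemma loop_generator_induct [consumes 1, case_names zero add h e]:
  assumes "p \<in> loop L"
    and P0: "P 0"
    and add: "\<And>p q. p \<in> loop L \<Longrightarrow> q \<in> loop L \<Longrightarrow> P p \<Longrightarrow> P q \<Longrightarrow> P (p + q)"
    and h: "\<And>i f. i \<in> I \<Longrightarrow> P (tensor scale (h i) f)"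
    and e: "\<And>i f. i \<in> I \<Longrightarrow> P (tensor scale (e i) f)"
  shows "P p"
  using subspace_L assms(1)
proof (induction p rule: loop_induct)
  case (tensor x f)
  let ?t = "\<lambda>i. tensor scale (h i) (laurent_scale (h_coord i x) f)
    + tensor scale (e i) (laurent_scale (e_coord i x) f)"
  have "(\<Sum>i\<in>J. ?t i) \<in> loop L \<and> P (\<Sum>i\<in>J. ?t i)" if "finite J" "J \<subseteq> I" for J
    using that
  proof (induction J rule: finite_induct)
    case empty
    show ?case using P0 subspace_0[OF subspace_L] by (simp add: loop_def)
  next
    case (insert i J)
    thus ?case by (auto intro!: add add_in_loop h e)
  qed
  from this[OF finite_I] have "P (\<Sum>i\<in>I. ?t i)" by simp
  also have "(\<Sum>i\<in>I. ?t i) = tensor scale x f"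
  proof (rule poly_mapping_eqI)
    fix n
    have "Poly_Mapping.lookup (\<Sum>i\<in>I. ?t i) n
        = Poly_Mapping.lookup f n *s (\<Sum>i\<in>I. h_coord i x *s h i + e_coord i x *s e i)"
      by (simp add: lookup_sum lookup_add scale_sum_right scale_right_distrib mult.commute)
    thus "Poly_Mapping.lookup (\<Sum>i\<in>I. ?t i) n = Poly_Mapping.lookup (tensor scale x f) n"
      using L_expansion[OF tensor] by simp
  qed
  finally show ?case .
qed (rule add)

lemma loop_br_in_loop [simp]: "p \<in> loop L \<Longrightarrow> q \<in> loop L \<Longrightarrow> loop_br br p q \<in> loop L"
  by (rule loop_br_closed[OF subalgebra_L])

lemma loop_coord_br:
  assumes "p \<in> loop L" "q \<in> loop L" "i \<in> I"
  shows "h_loop i (loop_br br p q) = 0"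
    and "e_loop i (loop_br br p q) = h_loop i p * e_loop i q - e_loop i p * h_loop i q"
proof -
  have "h_loop i (loop_br br p q) = 0 \<and>
      e_loop i (loop_br br p q) = h_loop i p * e_loop i q - e_loop i p * h_loop i q"
    using subspace_L assms(1)
  proof (induction p rule: loop_induct)
    case (tensor x f)
    from subspace_L assms(2) show ?case
    proof (induction q rule: loop_induct)
      case (tensor y g)
      have "br x y \<in> L" using subalgebra_L \<open>x \<in> L\<close> tensor by (auto simp: subalgebra_def)
      moreover have single: "Poly_Mapping.single 0 (a * b - a' * b')
          = Poly_Mapping.single (0::int) a * Poly_Mapping.single 0 b
            - Poly_Mapping.single 0 a' * Poly_Mapping.single 0 b'" for a b a' b' :: 'f
        by (simp add: mult_single single_diff)
      ultimately show ?case
        using \<open>x \<in> L\<close> tensor assms(3) by (simp add: loop_br_tensor coord_br single) (simp add: algebra_simps)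
    qed (use \<open>x \<in> L\<close> assms(3) in
        \<open>simp add: loop_br_add_right tensor_in_loop subspace_L algebra_simps\<close>)
  qed (use assms(2,3) in \<open>simp add: loop_br_add_left algebra_simps\<close>)
  thus "h_loop i (loop_br br p q) = 0"
    "e_loop i (loop_br br p q) = h_loop i p * e_loop i q - e_loop i p * h_loop i q" by blast+
qed

section \<open>A derivation of the loop algebra in coordinates\<close>

context
  fixes D
  assumes D: "D \<in> Der (pm_scale scale) (loop_br br) (loop L)"
begin

text \<open>These are d_i, p_i and b_i. The names \<open>h_coeff\<close> and \<open>e_coeff\<close>
  refer to the vector whose adjoint map is multiplied; hence p_i is read off from the image of e_i,
  and b_i from the image of h_i.\<close>

abbreviation (input) der_coeff where "der_coeff i f \<equiv> h_loop i (D (tensor scale (h i) f))"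
abbreviation (input) h_coeff where "h_coeff i \<equiv> e_loop i (D (tensor scale (e i) 1))"
abbreviation (input) e_coeff where "e_coeff i \<equiv> e_loop i (D (tensor scale (h i) 1))"

lemma derivation_linear: "D \<in> linear_maps (pm_scale scale) (loop L) (pm_scale scale) (loop L)"
  using D by (simp add: Der_def)

lemma derivation_closed [simp]: "p \<in> loop L \<Longrightarrow> D p \<in> loop L"
  and derivation_add: "p \<in> loop L \<Longrightarrow> q \<in> loop L \<Longrightarrow> D (p + q) = D p + D q"
  and derivation_scale: "p \<in> loop L \<Longrightarrow> D (pm_scale scale c p) = pm_scale scale c (D p)"
  and derivation_outside: "p \<notin> loop L \<Longrightarrow> D p = 0"
  using derivation_linear unfolding linear_maps_def by blast+

lemma derivation_zero: "D 0 = 0"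
  by (rule linear_maps_zero[OF vector_space_pm_scale vector_space_pm_scale
        subspace_loop[OF subspace_L] derivation_linear])

lemma derivation_tensor_br:
  assumes "x \<in> L" "y \<in> L"
  shows "D (tensor scale (br x y) (f * g))
    = loop_br br (D (tensor scale x f)) (tensor scale y g)
      + loop_br br (tensor scale x f) (D (tensor scale y g))"
proof -
  have "D (loop_br br (tensor scale x f) (tensor scale y g))
    = loop_br br (D (tensor scale x f)) (tensor scale y g)
      + loop_br br (tensor scale x f) (D (tensor scale y g))"
    using D tensor_in_loop[OF subspace_L assms(1)] tensor_in_loop[OF subspace_L assms(2)]
    unfolding Der_def by blast
  thus ?thesis by (simp add: loop_br_tensor)
qed

lemma tensor_zero [simp]: "tensor scale 0 f = 0" "tensor scale x 0 = 0"
  by (simp_all add: poly_mapping_eq_iff fun_eq_iff)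

text \<open>This is the e-coordinate of D applied to [h_i \<otimes> g, e_i \<otimes> f]. With f = 1
  it computes D on e_i \<otimes> g; for general f it yields the Leibniz rule for d_i.\<close>

lemma derivation_e_e:
  assumes i: "i \<in> I"
  shows "e_loop i (D (tensor scale (e i) (f * g)))
    = f * der_coeff i g + g * e_loop i (D (tensor scale (e i) f))"
  using arg_cong[OF derivation_tensor_br[OF h_in_L[OF i] e_in_L[OF i], of g f], of "e_loop i"] i
  by (simp add: loop_coord_br br_h_e h_in_L e_in_L mult.commute)

lemma derivation_e:
  assumes i: "i \<in> I"
  shows "D (tensor scale (e i) f) = tensor scale (e i) (der_coeff i f + h_coeff i * f)"
proof (rule loop_eqI)
  fix j assume j: "j \<in> I"
  \<comment> \<open>Since [h_i, e_i] = e_i, the image of e_i \<otimes> f is a sum of brackets, so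
    its h-coordinates vanish. One argument of each bracket lies in the i-th summand, so the
    e-coordinates for j \<noteq> i vanish too.\<close>
  have eq: "D (tensor scale (e i) f)
      = loop_br br (D (tensor scale (h i) 1)) (tensor scale (e i) f)
      + loop_br br (tensor scale (h i) 1) (D (tensor scale (e i) f))"
    using derivation_tensor_br[OF h_in_L[OF i] e_in_L[OF i], of 1 f] i by (simp add: br_h_e)
  show "h_loop j (D (tensor scale (e i) f))
      = h_loop j (tensor scale (e i) (der_coeff i f + h_coeff i * f))"
    using i j by (subst eq) (simp add: loop_coord_br e_in_L)
  show "e_loop j (D (tensor scale (e i) f))
      = e_loop j (tensor scale (e i) (der_coeff i f + h_coeff i * f))"
  proof (cases "j = i")
    case True
    thus ?thesis using derivation_e_e[OF i, of 1 f] i by (simp add: e_in_L mult.commute)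
  next
    case False
    thus ?thesis using i j by (subst eq) (simp add: loop_coord_br e_in_L h_in_L)
  qed
qed (use i in auto)

lemma derivation_h:
  assumes i: "i \<in> I"
  shows "D (tensor scale (h i) f)
    = tensor scale (h i) (der_coeff i f) + tensor scale (e i) (e_coeff i * f)"
proof (rule loop_eqI)
  fix j assume j: "j \<in> I"
  \<comment> \<open>For j \<noteq> i, D is applied to [h_i \<otimes> f, e_j \<otimes> 1] = 0:
    bracketing with e_j detects the h_j-coordinate.\<close>
  have "h_loop j (D (tensor scale (h i) f)) = 0" if "j \<noteq> i"
    using arg_cong[OF derivation_tensor_br[OF h_in_L[OF i] e_in_L[OF j], of f 1], of "e_loop j"]
      i j that by (simp add: loop_coord_br br_h_e h_in_L e_in_L derivation_zero)
  thus "h_loop j (D (tensor scale (h i) f))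
      = h_loop j (tensor scale (h i) (der_coeff i f) + tensor scale (e i) (e_coeff i * f))"
    using i j by (auto simp: h_in_L e_in_L)
  \<comment> \<open>D is applied to [h_i \<otimes> f, h_j \<otimes> 1] = 0. The e_j-coordinate of
    the result reads off the claim, with the term b_i f appearing for j = i only.\<close>
  show "e_loop j (D (tensor scale (h i) f))
      = e_loop j (tensor scale (h i) (der_coeff i f) + tensor scale (e i) (e_coeff i * f))"
    using arg_cong[OF derivation_tensor_br[OF h_in_L[OF i] h_in_L[OF j], of f 1], of "e_loop j"] i j
    by (auto simp: loop_coord_br br_h_h h_in_L e_in_L derivation_zero mult.commute)
qed (use i in \<open>auto intro!: add_in_loop\<close>)

text \<open>The e-coordinate of D on e_i \<otimes> fg is computed directly and through the product f
  g; the common term p_i f g cancels and the Leibniz rule remains.\<close>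

lemma der_coeff_Der:
  assumes i: "i \<in> I"
  shows "(\<lambda>f. der_coeff i f) \<in> Der_laurent"
proof -
  have "der_coeff i (f * g) = der_coeff i f * g + f * der_coeff i g" for f g
  proof -
    have E: "e_loop i (D (tensor scale (e i) f)) = der_coeff i f + h_coeff i * f" for f
      using i by (subst derivation_e) (auto simp: e_in_L)
    have "der_coeff i (f * g) + h_coeff i * (f * g)
        = f * der_coeff i g + g * (der_coeff i f + h_coeff i * f)"
      using derivation_e_e[OF i, of f g] by (simp only: E[of "f * g"] E[of f])
    thus ?thesis by (simp add: algebra_simps)
  qed
  moreover have "der_coeff i (f + g) = der_coeff i f + der_coeff i g"
    "der_coeff i (laurent_scale c f) = laurent_scale c (der_coeff i f)" for f g c
    using i by (simp_all add: tensor_bilinear derivation_add derivation_scale)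
  ultimately show ?thesis by (simp add: Der_def linear_maps_def)
qed

text \<open>Both sides are linear on the loop algebra and zero outside it, so it suffices to compare
  them on the tensors of h_i and of e_i, where the two preceding formulas apply.\<close>

lemma derivation_decomposition:
  "D = (\<Sum>i\<in>I. tensor_map scale L (ad_h i) (\<lambda>f. h_coeff i * f)
          + tensor_map scale L (ad_neg_e i) (\<lambda>f. e_coeff i * f))
     + (\<Sum>i\<in>I. tensor_map scale L (proj i) (\<lambda>f. der_coeff i f))" (is "D = ?R")
proof
  interpret P: vector_space "pm_scale scale" by (rule vector_space_pm_scale)
  interpret F: vector_space "fun_scale (pm_scale scale) :: _ \<Rightarrow> ((int \<Rightarrow>\<^sub>0 'a) \<Rightarrow> _) \<Rightarrow> _"
    by (rule P.vector_space_fun_scale)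
  let ?lin = "linear_maps (pm_scale scale) (loop L) (pm_scale scale) (loop L)"
  have dlin: "(\<lambda>f. der_coeff i f) \<in> linear_maps laurent_scale UNIV laurent_scale UNIV"
    if "i \<in> I" for i using der_coeff_Der[OF that] by (simp add: Der_def)
  have sub: "F.subspace ?lin"
    by (rule subspace_linear_maps[OF P.vector_space_axioms P.vector_space_axioms])
      (rule subspace_loop[OF subspace_L])
  have R: "?R \<in> ?lin"
    by (intro F.subspace_add[OF sub] F.subspace_sum[OF sub] tensor_map_linear subspace_L
        summand_maps_linear laurent_mult_linear dlin)
  note tm = tensor_map_tensor[OF vector_space_axioms subspace_L]
  have tm1: "tensor_map scale L (ad_h i) (\<lambda>f. u * f) (tensor scale x f) = tensor scale (ad_h i x) (u * f)"
    "tensor_map scale L (ad_neg_e i) (\<lambda>f. u * f) (tensor scale x f) = tensor scale (ad_neg_e i x) (u * f)"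
    "tensor_map scale L (proj i) (\<lambda>f. der_coeff i f) (tensor scale x f) = tensor scale (proj i x) (der_coeff i f)"
    if "i \<in> I" "x \<in> L" for i x u f
    using that by (intro tm summand_maps_linear laurent_mult_linear dlin; simp)+
  fix p
  show "D p = ?R p"
  proof (cases "p \<in> loop L")
    case True
    thus ?thesis
    proof (induction p rule: loop_generator_induct)
      case zero
      show ?case
        unfolding derivation_zero
        by (rule linear_maps_zero[OF P.vector_space_axioms P.vector_space_axioms
              subspace_loop[OF subspace_L] R, symmetric])
    next
      case (add p q)
      have "?R (p + q) = ?R p + ?R q" using R add(1,2) unfolding linear_maps_def by blast
      thus ?case using add by (simp only: derivation_add)
    next
      case (h i f)
      have "?R (tensor scale (h i) f)
          = tensor scale (h i) (der_coeff i f) + tensor scale (e i) (e_coeff i * f)"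
        using h finite_I
        by (simp add: sum_fun_apply tm1 h_in_L if_distrib[of "\<lambda>x. tensor scale x _"]
            sum.distrib cong: if_cong)
      from derivation_h[OF h] this[symmetric] show ?case by (rule trans)
    next
      case (e i f)
      have "?R (tensor scale (e i) f)
          = tensor scale (e i) (der_coeff i f + h_coeff i * f)"
        using e finite_I
        by (simp add: sum_fun_apply tm1 e_in_L if_distrib[of "\<lambda>x. tensor scale x _"]
            tensor_bilinear sum.distrib cong: if_cong)
      from derivation_e[OF e] this[symmetric] show ?case by (rule trans)
    qed
  next
    case False
    thus ?thesis using R derivation_outside by (simp add: linear_maps_def)
  qed
qed

text \<open>For \<open>p = h i \<otimes> f\<close> all elements \<open>[p, q]\<close> have \<open>h\<close>-coordinates \<open>0\<close>, so an almost inner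
  derivation has no centroid part.\<close>

lemma almost_inner_imp_inner:
  assumes ai: "almost_inner_derivation (loop_br br) (loop L) D"
  shows "inner_derivation (loop_br br) (loop L) D"
proof -
  interpret P: vector_space "pm_scale scale" by (rule vector_space_pm_scale)
  have d: "der_coeff i f = 0" if i: "i \<in> I" for i f
  proof -
    have "tensor scale (h i) f \<in> loop L" using i by simp
    with ai obtain q where "q \<in> loop L" "D (tensor scale (h i) f) = loop_br br (tensor scale (h i) f) q"
      unfolding almost_inner_derivation_def by blast
    thus ?thesis using i by (simp add: loop_coord_br)
  qed
  \<comment> \<open>The minus sign compensates [e_i, h_i] = -e_i: the bracket of -b_i e_i with h_i
    \<otimes> f is b_i f e_i.\<close>
  define y where "y = (\<Sum>i\<in>I. tensor scale (h i) (h_coeff i) + tensor scale (e i) (- e_coeff i))"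
  have y: "y \<in> loop L"
    unfolding y_def by (intro P.subspace_sum[OF subspace_loop[OF subspace_L]] add_in_loop) auto
  have y_coord: "h_loop i y = h_coeff i" "e_loop i y = - e_coeff i" if "i \<in> I" for i
    using that finite_I
    by (simp_all add: y_def loop_coord_sum add_in_loop h_in_L e_in_L sum_negf
        if_distrib[of "\<lambda>c. Poly_Mapping.single 0 c * _"] cong: if_cong)
  have "D p = loop_br br y p" if "p \<in> loop L" for p
    using that
  proof (induction p rule: loop_generator_induct)
    case zero
    show ?case by (simp add: loop_br_def derivation_zero)
  next
    case (add p q)
    thus ?case by (simp add: derivation_add loop_br_add_right)
  next
    case (h i f)
    show ?case
      by (rule loop_eqI; (subst derivation_h[OF h])?)
        (use h y in \<open>auto simp: d loop_coord_br y_coord h_in_L e_in_L\<close>)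
  next
    case (e i f)
    show ?case
      by (rule loop_eqI; (subst derivation_e[OF e])?)
        (use e y in \<open>auto simp: d loop_coord_br y_coord h_in_L e_in_L\<close>)
  qed
  with y show ?thesis unfolding inner_derivation_def by blast
qed

end

lemma Der_loop_eq:
  "Der (pm_scale scale) (loop_br br) (loop L)
    = {A + B | A B. A \<in> Der_tensor_laurent scale br L \<and> B \<in> Cent_tensor_Der_laurent scale br L}"
proof -
  interpret P: vector_space "pm_scale scale" by (rule vector_space_pm_scale)
  interpret F: vector_space "fun_scale (pm_scale scale) :: _ \<Rightarrow> ((int \<Rightarrow>\<^sub>0 'a) \<Rightarrow> _) \<Rightarrow> _"
    by (rule P.vector_space_fun_scale)
  show ?thesis
  proof (intro equalityI subsetI)
    fix D assume D: "D \<in> Der (pm_scale scale) (loop_br br) (loop L)"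
    show "D \<in> {A + B | A B. A \<in> Der_tensor_laurent scale br L \<and> B \<in> Cent_tensor_Der_laurent scale br L}"
    proof (subst derivation_decomposition[OF D], intro CollectI exI conjI, rule refl)
      show "(\<Sum>i\<in>I. tensor_map scale L (ad_h i) (\<lambda>f. e_loop i (D (tensor scale (e i) 1)) * f)
          + tensor_map scale L (ad_neg_e i) (\<lambda>f. e_loop i (D (tensor scale (h i) 1)) * f))
        \<in> Der_tensor_laurent scale br L"
        unfolding Der_tensor_laurent_def
        by (intro F.span_sum F.span_add F.span_base; use ad_h_in_Der ad_neg_e_in_Der in blast)
      show "(\<Sum>i\<in>I. tensor_map scale L (proj i) (\<lambda>f. h_loop i (D (tensor scale (h i) f))))
        \<in> Cent_tensor_Der_laurent scale br L"
        unfolding Cent_tensor_Der_laurent_def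
        by (intro F.span_sum F.span_base; use proj_in_Cent der_coeff_Der[OF D] in blast)
    qed
  next
    fix D
    assume "D \<in> {A + B | A B. A \<in> Der_tensor_laurent scale br L \<and> B \<in> Cent_tensor_Der_laurent scale br L}"
    thus "D \<in> Der (pm_scale scale) (loop_br br) (loop L)"
      using Der_tensor_laurent_subset[OF subalgebra_L] Cent_tensor_Der_laurent_subset[OF subalgebra_L]
        F.subspace_add[OF subspace_Der_loop[OF subspace_L]] by blast
  qed
qed

end

section \<open>Diagonalizable maps\<close>

context vector_space
begin

text \<open>In an eigenbasis the map multiplies coordinates by eigenvalues. For \<open>b\<close>
  outside \<open>B\<close> both coordinates are 0, so the value of \<open>c b\<close> there is
  arbitrary.\<close>

lemma diagonalizable_representation:
  assumes T: "Vector_Spaces.linear scale scale T" and "diagonalizable scale T"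
  obtains B c where "independent B" "span B = UNIV"
    "\<And>x b. representation B (T x) b = c b * representation B x b"
proof -
  interpret T: Vector_Spaces.linear scale scale T by fact
  obtain B where B: "independent B" "span B = UNIV" and "\<forall>b\<in>B. \<exists>c. T b = scale c b"
    using assms(2) unfolding diagonalizable_def by blast
  then obtain c where c: "\<And>b. b \<in> B \<Longrightarrow> T b = scale (c b) b" by metis
  have "representation B (T x) = (\<lambda>b. c b * representation B x b)" for x
  proof (rule representation_eqI[OF B(1)])
    let ?S = "{b. representation B x b \<noteq> 0}"
    have S: "?S \<subseteq> B" using representation_ne_zero by blast
    have fin: "finite ?S" by (rule finite_representation)
    show "T x \<in> span B" by (simp add: B)
    show "b \<in> B" if "c b * representation B x b \<noteq> 0" for b
      using that S by auto
    show "finite {b. c b * representation B x b \<noteq> 0}"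
      by (rule finite_subset[OF _ fin]) auto
    have "(\<Sum>b | c b * representation B x b \<noteq> 0. scale (c b * representation B x b) b)
        = (\<Sum>b\<in>?S. scale (c b * representation B x b) b)"
      by (rule sum.mono_neutral_left[OF fin]) auto
    also have "\<dots> = (\<Sum>b\<in>?S. T (scale (representation B x b) b))"
      using S by (intro sum.cong) (auto simp: T.scale c mult.commute)
    also have "\<dots> = T (\<Sum>b\<in>?S. scale (representation B x b) b)"
      by (simp add: T.sum)
    also have "(\<Sum>b\<in>?S. scale (representation B x b) b) = x"
      by (rule sum_nonzero_representation_eq[OF B(1)]) (simp add: B)
    finally show "(\<Sum>b | c b * representation B x b \<noteq> 0. scale (c b * representation B x b) b) = T x" .
  qed
  with that B show thesis by metis
qed

lemma zero_if_representation_zero: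
  assumes "independent B" "span B = UNIV" "\<And>b. representation B x b = 0"
  shows "x = 0"
  using sum_nonzero_representation_eq[OF assms(1), of x] assms by simp

text \<open>A diagonalizable map has no nilpotent part: in eigencoordinates c (c r) = 0 forces c r =
  0.\<close>

lemma diagonalizable_kernel_square:
  assumes T: "Vector_Spaces.linear scale scale T" and d: "diagonalizable scale T" and "T (T x) = 0"
  shows "T x = 0"
proof -
  obtain B c where B: "independent B" "span B = UNIV"
    and rep: "\<And>x b. representation B (T x) b = c b * representation B x b"
    using diagonalizable_representation[OF T d] by blast
  have "c b * (c b * representation B x b) = 0" for b
    using rep[of "T x" b] by (simp add: assms(3) rep representation_zero)
  thus ?thesis by (intro zero_if_representation_zero[OF B]) (auto simp: rep)
qed

text \<open>Subtracting a suitable multiple of \<open>x\<close> from \<open>T x\<close> decreases the number of nonzero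
  coordinates with respect to an eigenbasis.\<close>

lemma diagonalizable_eigenvector_in_invariant_subspace:
  assumes T: "Vector_Spaces.linear scale scale T" and d: "diagonalizable scale T"
    and V: "subspace V" "\<And>x. x \<in> V \<Longrightarrow> T x \<in> V" and "x \<in> V" "x \<noteq> 0"
  obtains y c where "y \<in> V" "y \<noteq> 0" "T y = scale c y"
proof -
  obtain B c where B: "independent B" "span B = UNIV"
    and rep: "\<And>x b. representation B (T x) b = c b * representation B x b"
    using diagonalizable_representation[OF T d] by blast
  let ?S = "\<lambda>x. {b. representation B x b \<noteq> 0}"
  have "\<exists>y\<in>V. y \<noteq> 0 \<and> (\<exists>c. T y = scale c y)"
    using assms(5,6)
  proof (induction "card (?S x)" arbitrary: x rule: less_induct)
    case less
    obtain b where b: "b \<in> ?S x"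
      using zero_if_representation_zero[OF B, of x] less.prems by blast
    let ?y = "T x - scale (c b) x"
    show ?case
    proof (cases "?y = 0")
      case True
      thus ?thesis using less.prems by auto
    next
      case False
      have "representation B ?y b' = (c b' - c b) * representation B x b'" for b'
        by (simp add: representation_diff[OF B(1)] representation_scale[OF B(1)] B(2) rep
            left_diff_distrib)
      hence "?S ?y \<subset> ?S x" using b by auto
      hence "card (?S ?y) < card (?S x)"
        by (intro psubset_card_mono finite_representation)
      moreover have "?y \<in> V" using less.prems V by (auto intro: subspace_diff subspace_scale)
      ultimately show ?thesis using less.hyps False by blast
    qed
  qed
  with that show thesis by blast
qed

end

context finite_dimensional_vector_space
begin

text \<open>If some member is not scalar on \<open>V\<close>, one of its eigenspaces in
  \<open>V\<close> is nonzero, proper, and invariant because the family commutes. The induction runs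
  on \<open>dim V\<close>, so the family may be infinite, as ad H is.\<close>

lemma commuting_diagonalizable_common_eigenvector:
  assumes lin: "\<And>T. T \<in> F \<Longrightarrow> Vector_Spaces.linear scale scale T"
    and diag: "\<And>T. T \<in> F \<Longrightarrow> diagonalizable scale T"
    and comm: "\<And>S T x. S \<in> F \<Longrightarrow> T \<in> F \<Longrightarrow> S (T x) = T (S x)"
    and "subspace V" "\<And>T x. T \<in> F \<Longrightarrow> x \<in> V \<Longrightarrow> T x \<in> V" "V \<noteq> {0}"
  shows "\<exists>x\<in>V. x \<noteq> 0 \<and> (\<forall>T\<in>F. \<exists>c. T x = scale c x)"
  using assms(4-6)
proof (induction "dim V" arbitrary: V rule: less_induct)
  case less
  obtain x where x: "x \<in> V" "x \<noteq> 0" using less.prems subspace_0 by blast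
  show ?case
  proof (cases "\<forall>T\<in>F. \<exists>c. \<forall>x\<in>V. T x = scale c x")
    case True
    with x show ?thesis by blast
  next
    case False
    then obtain T where T: "T \<in> F" and not_scalar: "\<And>c. \<exists>x\<in>V. T x \<noteq> scale c x" by blast
    interpret T: Vector_Spaces.linear scale scale T by (rule lin[OF T])
    obtain y c where y: "y \<in> V" "y \<noteq> 0" "T y = scale c y"
      using diagonalizable_eigenvector_in_invariant_subspace
        [OF lin[OF T] diag[OF T] less.prems(1) less.prems(2)[OF T] x] by blast
    define W where "W = {x \<in> V. T x = scale c x}"
    have W: "subspace W"
      using less.prems(1)
      by (auto simp: W_def subspace_def T.add T.scale scale_right_distrib mult.commute T.zero)
    have "W \<subset> V" using not_scalar[of c] by (auto simp: W_def)
    hence "dim W < dim V"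
      using subspace_dim_equal[OF W less.prems(1)] by (cases "dim V \<le> dim W") auto
    moreover have "S x \<in> W" if "S \<in> F" "x \<in> W" for S x
    proof -
      interpret S: Vector_Spaces.linear scale scale S by (rule lin) fact
      have x: "x \<in> V" "T x = scale c x" using that(2) by (auto simp: W_def)
      have "T (S x) = S (T x)" by (rule comm[OF T that(1)])
      also have "\<dots> = scale c (S x)" unfolding x(2) by (rule S.scale)
      finally show ?thesis using less.prems(2)[OF that(1) x(1)] by (simp add: W_def)
    qed
    moreover have "W \<noteq> {0}" using y by (auto simp: W_def)
    ultimately have "\<exists>x\<in>W. x \<noteq> 0 \<and> (\<forall>T\<in>F. \<exists>c. T x = scale c x)"
      using W by (intro less.hyps)
    thus ?thesis unfolding W_def by blast
  qed
qed

text \<open>Starting from a maximal partial dual family, a vector on which all its members vanish could be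
  used to enlarge it.\<close>

lemma dual_family_exists:
  assumes V: "subspace V" and F: "finite F" "card F \<le> dim V"
    and add: "\<And>f x y. f \<in> F \<Longrightarrow> x \<in> V \<Longrightarrow> y \<in> V \<Longrightarrow> f (x + y) = f x + f y"
    and scale: "\<And>f x c. f \<in> F \<Longrightarrow> x \<in> V \<Longrightarrow> f (scale c x) = c * f x"
    and sep: "\<And>x. x \<in> V \<Longrightarrow> (\<And>f. f \<in> F \<Longrightarrow> f x = 0) \<Longrightarrow> x = 0"
  obtains h where "h ` F \<subseteq> V" "V \<subseteq> span (h ` F)"
    "\<And>f g. f \<in> F \<Longrightarrow> g \<in> F \<Longrightarrow> f (h g) = (if f = g then 1 else 0)"
proof -
  define dual where "dual G h \<longleftrightarrow>
    G \<subseteq> F \<and> h ` G \<subseteq> V \<and> (\<forall>f\<in>G. \<forall>g\<in>G. f (h g) = (if f = g then 1 else 0))" for G h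
  have "dual {} (\<lambda>_. 0)" by (simp add: dual_def)
  moreover have "card G < Suc (card F)" if "dual G h" for G h
    using that F(1) by (auto simp: dual_def less_Suc_eq_le intro: card_mono)
  ultimately have "\<exists>G. (\<exists>h. dual G h) \<and> (\<forall>G'. (\<exists>h. dual G' h) \<longrightarrow> card G' \<le> card G)"
    by (intro ex_has_greatest_nat[of "\<lambda>G. \<exists>h. dual G h" "{}" card "Suc (card F)"]) blast+
  then obtain G h where Gh: "dual G h" and max: "\<And>G' h. dual G' h \<Longrightarrow> card G' \<le> card G" by blast
  have G: "G \<subseteq> F" "finite G" using Gh F(1) by (auto simp: dual_def intro: finite_subset)
  have hV: "h g \<in> V" if "g \<in> G" for g using Gh that by (auto simp: dual_def)
  have dlt: "f (h g) = (if f = g then 1 else 0)" if "f \<in> G" "g \<in> G" for f g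
    using Gh that by (auto simp: dual_def)
  have f_sum: "f (\<Sum>j\<in>J. y j) = (\<Sum>j\<in>J. f (y j))" if "f \<in> F" "\<And>j. j \<in> J \<Longrightarrow> y j \<in> V"
    for f :: "'b \<Rightarrow> 'a" and y :: "('b \<Rightarrow> 'a) \<Rightarrow> 'b" and J
    using that(2)
  proof (induction J rule: infinite_finite_induct)
    case (insert j J)
    thus ?case using add[OF that(1)] by (simp add: subspace_sum[OF V])
  qed (use scale[OF that(1) subspace_0[OF V], of 0] in simp_all)
  have "x \<in> span (h ` G)" if x: "x \<in> V" for x
  proof -
    \<comment> \<open>\<open>s\<close> has the same values as \<open>x\<close> under the members of
      \<open>G\<close>, so \<open>w\<close> is killed by all of them. The difference is written with
      the scalar -1 so that \<open>add\<close> and \<open>scale\<close> apply to it.\<close>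
    define s where "s = (\<Sum>g\<in>G. scale (g x) (h g))"
    define w where "w = x + scale (- 1) s"
    have s: "s \<in> V" unfolding s_def by (intro subspace_sum[OF V] subspace_scale[OF V] hV)
    have w: "w \<in> V" using x s by (simp add: w_def subspace_diff V)
    have w0: "g w = 0" if g: "g \<in> G" for g
    proof -
      have "g s = (\<Sum>f\<in>G. f x * g (h f))"
        unfolding s_def using g G hV by (subst f_sum) (auto simp: subspace_scale V scale)
      also have "\<dots> = g x" using g G(2) by (simp add: dlt if_distrib[of "\<lambda>c. _ * c"] cong: if_cong)
      finally have "g s = g x" .
      thus ?thesis
        unfolding w_def using g G(1) x s by (auto simp: add scale subspace_scale V subsetD[OF G(1)] simp del: scale_minus_left)
    qed
    have "w = 0"
    proof (rule ccontr)
      assume "w \<noteq> 0"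
      then obtain f where f: "f \<in> F" "f w \<noteq> 0" using sep[OF w] by blast
      have "f \<notin> G" using f w0 by blast
      define w' where "w' = scale (1 / f w) w"
      have w': "w' \<in> V" by (simp add: w'_def subspace_scale V w)
      have fw': "f w' = 1" using f w by (simp add: w'_def scale)
      have gw': "g w' = 0" if "g \<in> G" for g using that w0 w G(1) by (auto simp: w'_def scale)
      \<comment> \<open>The old vectors are corrected to be killed by \<open>f\<close>. Members of
        \<open>G\<close> vanish at \<open>w'\<close>, so the duality relations inside
        \<open>G\<close> survive.\<close>
      define h' where "h' g = (if g = f then w' else h g - scale (f (h g)) w')" for g
      have "dual (insert f G) h'"
        unfolding dual_def
      proof (intro conjI ballI)
        show "insert f G \<subseteq> F" using f G by auto
        show "h' ` insert f G \<subseteq> V"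
          by (auto simp: h'_def w' hV subspace_diff subspace_scale V)
        fix g g' assume mem: "g \<in> insert f G" "g' \<in> insert f G"
        have upd: "f' (h g' - scale (f (h g')) w') = f' (h g') - f (h g') * f' w'"
          if f': "f' \<in> F" and g': "g' \<in> G" for f' g'
        proof -
          have "f' (h g' + scale (- f (h g')) w') = f' (h g') + - f (h g') * f' w'"
            by (simp only: add[OF f' hV[OF g'] subspace_scale[OF V w']] scale[OF f' w'])
          thus ?thesis by simp
        qed
        show "g (h' g') = (if g = g' then 1 else 0)"
          using mem f(1) \<open>f \<notin> G\<close> upd[of f g'] upd[of g g'] subsetD[OF G(1), of g]
          by (auto simp: h'_def fw' gw' dlt)
      qed
      from max[OF this] \<open>f \<notin> G\<close> G(2) show False by simp
    qed
    hence "x = s" by (simp add: w_def)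
    moreover have "s \<in> span (h ` G)"
      unfolding s_def by (intro span_sum span_scale span_base) auto
    ultimately show ?thesis by simp
  qed
  hence span: "V \<subseteq> span (h ` G)" by blast
  \<comment> \<open>Spanning forces at least \<open>dim V\<close> members in \<open>G\<close>, and
    \<open>F\<close> has at most that many, so \<open>G\<close> exhausts \<open>F\<close>.\<close>
  have "dim V \<le> card (h ` G)" using G(2) by (intro dim_le_card span) auto
  also have "\<dots> \<le> card G" by (rule card_image_le[OF G(2)])
  finally have "G = F" using F G(1) by (intro card_subset_eq) (auto intro: order.antisym card_mono)
  with that[of h] Gh span show thesis unfolding dual_def by blast
qed

end

section \<open>Roots with respect to a torus\<close>

context lie_algebra
begin

lemma linear_br: "Vector_Spaces.linear scale scale (br x)"
  by unfold_locales (auto simp: br_add_right br_scale_right)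

lemma br_derivation: "br x (br y z) = br (br x y) z + br y (br x z)"
proof -
  have "br y (br z x) = - br y (br x z)"
    using br_scale_right[of y "- 1" "br x z"] by (subst br_skew[of z x]) simp
  moreover have "br z (br x y) = - br (br x y) z" by (rule br_skew)
  ultimately show ?thesis using jacobi[of x y z] by (simp add: algebra_simps)
qed

text \<open>If ad h is nonzero on H, its image there contains an eigenvector y = [h, z] with
  eigenvalue c. If c = 0, then ad h squared kills z, so y = 0. If c \<noteq> 0, then [y, h] = -c y
  is killed by ad y, and diagonalizability of ad y gives [y, h] = 0. Both are
  contradictions.\<close>

lemma torus_abelian:
  assumes H: "torus scale br H" and "g \<in> H" "h \<in> H"
  shows "br h g = 0"
proof (rule ccontr)
  assume "br h g \<noteq> 0"
  have H: "subspace H" "\<And>x y. x \<in> H \<Longrightarrow> y \<in> H \<Longrightarrow> br x y \<in> H"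
    and diag: "\<And>h. h \<in> H \<Longrightarrow> diagonalizable scale (br h)"
    using H by (auto simp: torus_def subalgebra_def)
  interpret ad: Vector_Spaces.linear scale scale "br h" by (rule linear_br)
  have "subspace (br h ` H)" using H(1) by (rule ad.subspace_image)
  moreover have "br h x \<in> br h ` H" if "x \<in> br h ` H" for x
    using that assms(3) H(2) by blast
  ultimately obtain y c where y: "y \<in> br h ` H" "y \<noteq> 0" "br h y = c *s y"
    using diagonalizable_eigenvector_in_invariant_subspace[OF linear_br diag[OF assms(3)],
        of "br h ` H" "br h g"] assms(2) \<open>br h g \<noteq> 0\<close> by blast
  then obtain z where z: "z \<in> H" "y = br h z" by blast
  show False
  proof (cases "c = 0")
    case True
    thus False
      using diagonalizable_kernel_square[OF linear_br diag[OF assms(3)], of z] y z by simp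
  next
    case False
    have "br y h = - (c *s y)" using br_skew[of y h] y(3) by simp
    hence "br y (br y h) = 0" using br_scale_right[of y "- c" y] by (simp add: br_self)
    hence "br y h = 0"
      using diagonalizable_kernel_square[OF linear_br diag, of y h] z H(2) assms(3) by blast
    thus False using \<open>br y h = - (c *s y)\<close> False y(2) by simp
  qed
qed

text \<open>The center is an abelian, hence solvable, ideal.\<close>

lemma semisimple_center:
  assumes "semisimple scale br" "\<And>x. br z x = 0"
  shows "z = 0"
proof -
  let ?Z = "{z. \<forall>x. br z x = 0}"
  have "br x z = 0" if "z \<in> ?Z" for x z using that br_skew[of x z] by simp
  hence "lie_ideal scale br ?Z"
    by (auto simp: lie_ideal_def subspace_def br_add_left br_scale_left)
  moreover have "{br x y | x y. x \<in> ?Z \<and> y \<in> ?Z} = {0}"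
    by (auto intro!: exI[of _ 0])
  hence "(derived_algebra scale br ^^ 1) ?Z = {0}"
    by (simp add: derived_algebra_def)
  hence "solvable scale br ?Z" unfolding solvable_def by blast
  ultimately have "?Z = {0}" using assms(1) unfolding semisimple_def by blast
  with assms(2) show ?thesis by blast
qed

text \<open>As for eigenvectors of one map: applying ad h - \<beta> h to a relation removes the
  \<beta>-term, where \<open>h\<close> is chosen separately for each remaining \<alpha> so that
  \<alpha> h \<noteq> \<beta> h.\<close>

lemma root_space_linear_independent:
  assumes \<alpha>: "finite F" "F \<subseteq> roots scale br H" and e: "\<And>\<alpha>. \<alpha> \<in> F \<Longrightarrow> e \<alpha> \<in> root_space scale br H \<alpha>"
    "\<And>\<alpha>. \<alpha> \<in> F \<Longrightarrow> e \<alpha> \<noteq> 0"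
    and "(\<Sum>\<alpha>\<in>F. c \<alpha> *s e \<alpha>) = 0" "\<alpha> \<in> F"
  shows "c \<alpha> = 0"
  using assms
proof (induction F arbitrary: c \<alpha> rule: finite_induct)
  case (insert \<beta> F)
  have c0: "c \<alpha> = 0" if \<alpha>: "\<alpha> \<in> F" for \<alpha>
  proof -
    have "\<alpha> \<noteq> \<beta>" using \<alpha> insert.hyps by blast
    then obtain h where h: "\<alpha> h \<noteq> \<beta> h" by blast
    have "\<alpha> \<in> linear_maps scale H (*) UNIV" "\<beta> \<in> linear_maps scale H (*) UNIV"
      using insert.prems(1) \<alpha> by (auto simp: roots_def)
    \<comment> \<open>Functionals take the value 0 outside \<open>H\<close>, so distinct ones can
      differ only inside \<open>H\<close>.\<close>
    hence "h \<in> H" using h unfolding linear_maps_def by force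
    have br: "br h (e \<gamma>) = \<gamma> h *s e \<gamma>" if "\<gamma> \<in> insert \<beta> F" for \<gamma>
      using insert.prems(2)[OF that] \<open>h \<in> H\<close> by (simp add: root_space_def)
    let ?s = "\<Sum>\<gamma>\<in>insert \<beta> F. c \<gamma> *s e \<gamma>"
    have "0 = br h ?s - \<beta> h *s ?s" by (simp add: insert.prems(4) del: sum.insert)
    also have "\<dots> = (\<Sum>\<gamma>\<in>insert \<beta> F. (c \<gamma> * (\<gamma> h - \<beta> h)) *s e \<gamma>)"
      by (simp add: br_sum_right br_scale_right br scale_sum_right right_diff_distrib
          scale_left_diff_distrib sum_subtractf mult.commute del: sum.insert)
    also have "\<dots> = (\<Sum>\<gamma>\<in>F. (c \<gamma> * (\<gamma> h - \<beta> h)) *s e \<gamma>)" using insert.hyps by simp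
    finally have "c \<alpha> * (\<alpha> h - \<beta> h) = 0"
      using insert.IH[of "\<lambda>\<gamma>. c \<gamma> * (\<gamma> h - \<beta> h)" \<alpha>] insert.prems \<alpha> by auto
    thus ?thesis using h by simp
  qed
  moreover from this have "c \<beta> *s e \<beta> = 0" using insert.prems(4) insert.hyps by simp
  hence "c \<beta> = 0" using insert.prems(3) by simp
  ultimately show ?case using insert.prems(5) by blast
qed simp

lemma root_vectors_independent:
  assumes \<Psi>: "\<Psi> \<subseteq> roots scale br H"
    and e: "\<And>\<alpha>. \<alpha> \<in> \<Psi> \<Longrightarrow> e \<alpha> \<in> root_space scale br H \<alpha>" "\<And>\<alpha>. \<alpha> \<in> \<Psi> \<Longrightarrow> e \<alpha> \<noteq> 0"
  shows "inj_on e \<Psi>" "independent (e ` \<Psi>)"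
proof -
  show inj: "inj_on e \<Psi>"
  proof (rule inj_onI, rule ccontr)
    fix \<alpha> \<beta> assume *: "\<alpha> \<in> \<Psi>" "\<beta> \<in> \<Psi>" "e \<alpha> = e \<beta>" "\<alpha> \<noteq> \<beta>"
    \<comment> \<open>Equal root vectors for distinct roots would give the relation with
      coefficients 1 and -1.\<close>
    have "(1::'f) = 0"
      using root_space_linear_independent[of "{\<alpha>, \<beta>}" H e "\<lambda>\<gamma>. if \<gamma> = \<alpha> then 1 else - 1" \<alpha>]
        * \<Psi> e by auto
    thus False by simp
  qed
  show "independent (e ` \<Psi>)"
    unfolding dependent_explicit
  proof clarify
    fix S u v
    assume S: "finite S" "S \<subseteq> e ` \<Psi>" and v: "v \<in> S" "u v \<noteq> 0" and sum: "(\<Sum>v\<in>S. u v *s v) = 0"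
    obtain F where F: "F \<subseteq> \<Psi>" "finite F" "S = e ` F" using finite_subset_image[OF S] by blast
    have "(\<Sum>\<alpha>\<in>F. u (e \<alpha>) *s e \<alpha>) = 0"
      using sum F(3) inj_on_subset[OF inj F(1)] by (simp add: sum.reindex)
    hence "u (e \<alpha>) = 0" if "\<alpha> \<in> F" for \<alpha>
      using root_space_linear_independent[of F H e "\<lambda>\<alpha>. u (e \<alpha>)" \<alpha>] that F \<Psi> e by blast
    thus False using v F(3) by auto
  qed
qed

end

section \<open>The structure of L inside the semisimple algebra\<close>

locale finite_dimensional_lie_algebra =
  lie_algebra scale br + finite_dimensional_vector_space scale Basis
  for scale :: "'f::field \<Rightarrow> 'a::ab_group_add \<Rightarrow> 'a" (infixr \<open>*s\<close> 75) and br Basis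
begin

text \<open>It suffices that \<open>h0\<close> is central. Otherwise the range of ad h0 is nonzero
  and invariant under ad H, so it contains a common eigenvector of ad H; its weight is a root that
  does not vanish at \<open>h0\<close>.\<close>

lemma roots_separate_torus:
  assumes ss: "semisimple scale br" and torus: "torus scale br H" and h0: "h0 \<in> H"
    and zero: "\<And>\<alpha>. \<alpha> \<in> roots scale br H \<Longrightarrow> \<alpha> h0 = 0"
  shows "h0 = 0"
proof (rule semisimple_center[OF ss], rule ccontr)
  fix x assume x: "br h0 x \<noteq> 0"
  have H: "subspace H" and diag: "\<And>h. h \<in> H \<Longrightarrow> diagonalizable scale (br h)"
    using torus by (auto simp: torus_def subalgebra_def)
  have comm: "br g (br h x) = br h (br g x)" if "g \<in> H" "h \<in> H" for g h x
    by (subst br_derivation) (simp add: torus_abelian[OF torus that(2,1)])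
  interpret ad: Vector_Spaces.linear scale scale "br h0" by (rule linear_br)
  have "\<exists>y\<in>range (br h0). y \<noteq> 0 \<and> (\<forall>T\<in>br ` H. \<exists>c. T y = c *s y)"
  proof (rule commuting_diagonalizable_common_eigenvector)
    show "subspace (range (br h0))" by (rule ad.subspace_image) simp
    show "range (br h0) \<noteq> {0}" using x by blast
    show "T y \<in> range (br h0)" if "T \<in> br ` H" "y \<in> range (br h0)" for T y
      using that comm[OF _ h0] by force
  qed (auto simp: linear_br diag comm)
  then obtain z where z: "br h0 z \<noteq> 0" and "\<forall>h\<in>H. \<exists>c. br h (br h0 z) = c *s br h0 z" by blast
  then obtain a where a: "\<And>h. h \<in> H \<Longrightarrow> br h (br h0 z) = a h *s br h0 z" by metis
  \<comment> \<open>The eigenvalues are cut off outside \<open>H\<close>, as membership in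
    \<open>linear_maps\<close> requires.\<close>
  define \<alpha> where "\<alpha> h = (if h \<in> H then a h else 0)" for h
  have br: "br h (br h0 z) = \<alpha> h *s br h0 z" if "h \<in> H" for h
    using a[OF that] that by (simp add: \<alpha>_def)
  have "\<alpha> (g + h) = \<alpha> g + \<alpha> h" if "g \<in> H" "h \<in> H" for g h
  proof -
    have "\<alpha> (g + h) *s br h0 z = (\<alpha> g + \<alpha> h) *s br h0 z"
      using br[OF subspace_add[OF H that]] by (simp add: br_add_left br that scale_left_distrib)
    thus ?thesis using z by simp
  qed
  moreover have "\<alpha> (c *s h) = c * \<alpha> h" if "h \<in> H" for c h
  proof -
    have "\<alpha> (c *s h) *s br h0 z = c *s br h (br h0 z)"
      using br[OF subspace_scale[OF H that]] by (simp only: br_scale_left)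
    also have "\<dots> = (c * \<alpha> h) *s br h0 z" by (simp add: br that)
    finally have "\<alpha> (c *s h) *s br h0 z = (c * \<alpha> h) *s br h0 z" .
    thus ?thesis using z by simp
  qed
  \<comment> \<open>The eigenvector is itself [h0, z]; weight 0 at \<open>h0\<close> would mean that
    ad h0 squared kills \<open>z\<close>, hence [h0, z] = 0.\<close>
  moreover have \<alpha>_h0: "\<alpha> h0 \<noteq> 0"
    using diagonalizable_kernel_square[OF linear_br diag[OF h0], of z] br[OF h0] z by auto
  moreover have "br h0 z \<in> root_space scale br H \<alpha>" using br by (simp add: root_space_def)
  moreover have "\<alpha> \<noteq> 0" using \<alpha>_h0 by auto
  moreover have "\<alpha> h = 0" if "h \<notin> H" for h using that by (simp add: \<alpha>_def)
  ultimately have "\<alpha> \<in> roots scale br H"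
    using z by (auto simp: roots_def linear_maps_def)
  with zero \<alpha>_h0 show False by blast
qed

text \<open>The root vectors of \<open>\<Psi>\<close> are independent in \<open>[L, L]\<close> and \<open>\<Psi>\<close> spans the dual of \<open>H\<close>, so the
  dimension hypothesis forces \<open>\<Psi>\<close> to be a basis of that dual; then no sum of two
  elements of \<open>\<Psi>\<close> is a root of \<open>L\<close>.\<close>

lemma Q_graded_sum_of_affine_algebras:
  assumes ss: "semisimple scale br" and torus: "torus scale br H"
    and L: "Q_graded scale br H L" and dim: "dim H = dim (derived_algebra scale br L)"
  obtains \<Psi> h e where "sum_of_affine_algebras scale br (\<Psi> :: ('a \<Rightarrow> 'f) set) h e L"
proof -
  have H: "subspace H" using torus by (auto simp: torus_def subalgebra_def)
  have abel: "br g h = 0" if "g \<in> H" "h \<in> H" for g h using torus_abelian[OF torus that(2,1)] .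
  obtain \<Psi> where \<Psi>: "\<Psi> \<subseteq> roots scale br H"
    and L_span: "L = span (H \<union> (\<Union>\<alpha>\<in>\<Psi>. root_space scale br H \<alpha>))"
    and closure: "group_closure \<Psi> = group_closure (roots scale br H)"
    using L by (auto simp: Q_graded_def)
  let ?R = "root_space scale br H" and ?L' = "derived_algebra scale br L"
  have lin: "\<alpha> \<in> linear_maps scale H (*) UNIV" "\<alpha> \<noteq> 0" if "\<alpha> \<in> \<Psi>" for \<alpha>
    using \<Psi> that by (auto simp: roots_def)
  have "\<exists>x. x \<in> ?R \<alpha> \<and> x \<noteq> 0" if "\<alpha> \<in> \<Psi>" for \<alpha>
  proof -
    have "0 \<in> ?R \<alpha>" by (simp add: root_space_def)
    moreover have "?R \<alpha> \<noteq> {0}" using \<Psi> that by (auto simp: roots_def)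
    ultimately show ?thesis by blast
  qed
  then obtain e where e: "\<And>\<alpha>. \<alpha> \<in> \<Psi> \<Longrightarrow> e \<alpha> \<in> ?R \<alpha>" "\<And>\<alpha>. \<alpha> \<in> \<Psi> \<Longrightarrow> e \<alpha> \<noteq> 0" by metis
  have H_L: "H \<subseteq> L" and R_L: "\<And>\<alpha>. \<alpha> \<in> \<Psi> \<Longrightarrow> ?R \<alpha> \<subseteq> L"
    unfolding L_span by (auto intro: span_base)
  have R_L': "?R \<alpha> \<subseteq> ?L'" if \<alpha>: "\<alpha> \<in> \<Psi>" for \<alpha>
  proof
    fix x assume x: "x \<in> ?R \<alpha>"
    \<comment> \<open>Such an \<open>h\<close> lies in \<open>H\<close>, and \<open>x\<close> is the
      multiple of [h, x] by the inverse of \<alpha> h.\<close>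
    obtain h where "\<alpha> h \<noteq> 0" using lin(2)[OF \<alpha>] by (auto simp: fun_eq_iff)
    with lin(1)[OF \<alpha>] have h: "h \<in> H" unfolding linear_maps_def by blast
    have "br h x \<in> ?L'"
      unfolding derived_algebra_def using h x H_L R_L[OF \<alpha>] by (intro span_base) blast
    hence "(1 / \<alpha> h) *s br h x \<in> ?L'" unfolding derived_algebra_def by (rule span_scale)
    moreover have "br h x = \<alpha> h *s x" using x h by (simp add: root_space_def)
    ultimately show "x \<in> ?L'" using \<open>\<alpha> h \<noteq> 0\<close> by simp
  qed
  note inj = root_vectors_independent(1)[OF \<Psi> e] and indep = root_vectors_independent(2)[OF \<Psi> e]
  have fin: "finite \<Psi>" using finiteI_independent[OF indep] inj by (rule finite_imageD)
  have e_L': "e ` \<Psi> \<subseteq> ?L'" using e(1) R_L' by blast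
  have "card \<Psi> = card (e ` \<Psi>)" using inj by (simp add: card_image)
  also have "\<dots> \<le> dim H" unfolding dim by (rule independent_card_le_dim[OF e_L' indep])
  finally have card: "card \<Psi> \<le> dim H" .
  \<comment> \<open>Vanishing at \<open>x\<close> passes to integer combinations of \<Psi>, hence to
    all roots.\<close>
  have sep: "x = 0" if x: "x \<in> H" and zero: "\<And>\<alpha>. \<alpha> \<in> \<Psi> \<Longrightarrow> \<alpha> x = 0" for x
  proof (rule roots_separate_torus[OF ss torus x])
    fix \<beta> assume "\<beta> \<in> roots scale br H"
    hence "\<beta> \<in> group_closure \<Psi>" unfolding closure by (auto intro: group_closure.base)
    thus "\<beta> x = 0" by (induction rule: group_closure.induct) (auto simp: zero)
  qed
  obtain h where h: "h ` \<Psi> \<subseteq> H" "H \<subseteq> span (h ` \<Psi>)"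
    and dual: "\<And>\<alpha> \<beta>. \<alpha> \<in> \<Psi> \<Longrightarrow> \<beta> \<in> \<Psi> \<Longrightarrow> \<alpha> (h \<beta>) = (if \<alpha> = \<beta> then 1 else 0)"
  proof (rule dual_family_exists[OF H fin card])
    show "\<alpha> (x + y) = \<alpha> x + \<alpha> y" if "\<alpha> \<in> \<Psi>" "x \<in> H" "y \<in> H" for \<alpha> x y
      using lin(1)[OF that(1)] that unfolding linear_maps_def by blast
    show "\<alpha> (c *s x) = c * \<alpha> x" if "\<alpha> \<in> \<Psi>" "x \<in> H" for \<alpha> c x
      using lin(1)[OF that(1)] that unfolding linear_maps_def by blast
  qed (use sep in blast)+
  \<comment> \<open>The dual family spans \<open>H\<close>, so dim [L, L] = dim H is at most the
    number of root vectors; being independent in [L, L], they span it.\<close>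
  have "dim H \<le> card (h ` \<Psi>)" using h(2) fin by (intro dim_le_card) auto
  also have "\<dots> \<le> card \<Psi>" by (rule card_image_le[OF fin])
  also have "\<dots> = card (e ` \<Psi>)" using inj by (simp add: card_image)
  finally have "dim ?L' \<le> card (e ` \<Psi>)" unfolding dim .
  hence L'_span: "?L' \<subseteq> span (e ` \<Psi>)"
    using card_ge_dim_independent[OF e_L' indep] by blast
  have he: "br (h \<alpha>) (e \<beta>) = (if \<alpha> = \<beta> then e \<beta> else 0)" if "\<alpha> \<in> \<Psi>" "\<beta> \<in> \<Psi>" for \<alpha> \<beta>
    using e(1)[OF that(2)] h(1) that dual[OF that(2,1)] by (auto simp: root_space_def)
  \<comment> \<open>On the span of the root vectors, ad of \<open>h \<alpha>\<close> is the
    coordinate projection to the line of \<open>e \<alpha>\<close>.\<close>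
  have h_span: "br (h \<alpha>) x \<in> span {e \<alpha>}" if "\<alpha> \<in> \<Psi>" "x \<in> span (e ` \<Psi>)" for \<alpha> x
  proof -
    interpret ad: Vector_Spaces.linear scale scale "br (h \<alpha>)" by (rule linear_br)
    have "br (h \<alpha>) ` span (e ` \<Psi>) \<subseteq> span {e \<alpha>}"
      unfolding ad.span_image[symmetric]
      by (rule span_minimal) (auto simp: he that intro: span_base span_zero)
    with that show ?thesis by blast
  qed
  \<comment> \<open>For \<alpha> \<noteq> \<beta> the bracket is fixed by ad of
    \<open>h \<alpha>\<close> and of \<open>h \<beta>\<close>. The former makes it a multiple of
    \<open>e \<alpha>\<close>, which the latter kills.\<close>
  have ee: "br (e \<alpha>) (e \<beta>) = 0" if \<alpha>: "\<alpha> \<in> \<Psi>" and \<beta>: "\<beta> \<in> \<Psi>" for \<alpha> \<beta>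
  proof (cases "\<alpha> = \<beta>")
    case False
    let ?z = "br (e \<alpha>) (e \<beta>)"
    have "?z \<in> ?L'"
      unfolding derived_algebra_def using e(1) R_L \<alpha> \<beta> by (intro span_base) blast
    hence z: "?z \<in> span (e ` \<Psi>)" using L'_span by blast
    have "br (h \<alpha>) ?z = ?z" "br (h \<beta>) ?z = ?z"
      using he \<alpha> \<beta> False by (simp_all add: br_derivation[of _ "e \<alpha>" "e \<beta>"])
    then obtain a where a: "?z = a *s e \<alpha>"
      using h_span[OF \<alpha> z] by (auto simp: span_singleton)
    have "?z = br (h \<beta>) (a *s e \<alpha>)" using \<open>br (h \<beta>) ?z = ?z\<close> a by simp
    thus ?thesis using he[OF \<beta> \<alpha>] False by (simp add: br_scale_right)
  qed (simp add: br_self)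
  have "sum_of_affine_algebras scale br \<Psi> h e L"
  proof unfold_locales
    show "L = span (h ` \<Psi> \<union> e ` \<Psi>)"
    proof
      show "L \<subseteq> span (h ` \<Psi> \<union> e ` \<Psi>)"
        unfolding L_span
      proof (rule span_minimal)
        have "H \<subseteq> span (h ` \<Psi> \<union> e ` \<Psi>)" using h(2) span_mono[of "h ` \<Psi>"] by blast
        \<comment> \<open>The whole root space, and not just the chosen vector, lies in [L, L] and
          so in the span of the root vectors.\<close>
        moreover have "?R \<alpha> \<subseteq> span (h ` \<Psi> \<union> e ` \<Psi>)" if "\<alpha> \<in> \<Psi>" for \<alpha>
          using R_L'[OF that] L'_span span_mono[of "e ` \<Psi>" "h ` \<Psi> \<union> e ` \<Psi>"] by blast
        ultimately show "H \<union> (\<Union>\<alpha>\<in>\<Psi>. ?R \<alpha>) \<subseteq> span (h ` \<Psi> \<union> e ` \<Psi>)" by blast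
      qed (rule subspace_span)
      show "span (h ` \<Psi> \<union> e ` \<Psi>) \<subseteq> L"
      proof (rule span_minimal)
        show "h ` \<Psi> \<union> e ` \<Psi> \<subseteq> L" using h(1) H_L e(1) R_L by blast
      qed (simp add: L_span)
    qed
    show "br (h \<alpha>) (h \<beta>) = 0" if "\<alpha> \<in> \<Psi>" "\<beta> \<in> \<Psi>" for \<alpha> \<beta>
      using that h(1) by (intro abel) auto
  qed (use fin e he ee in auto)
  thus thesis by (rule that)
qed

end

theorem theorem4p8:
  fixes scale :: "'f::{alg_closed_field, field_char_0} \<Rightarrow> 'a::ab_group_add \<Rightarrow> 'a"
    and Basis :: "'a set"
    and br :: "'a \<Rightarrow> 'a \<Rightarrow> 'a"
    and H L :: "'a set"
  assumes "finite_dimensional_vector_space scale Basis"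
    and "lie_algebra scale br"
    and "semisimple scale br"
    and "maximal_torus scale br H"
    and "minimal_Q_graded scale br H L"
    and "vector_space.dim scale H = vector_space.dim scale (derived_algebra scale br L)"
  shows "Der (pm_scale scale) (loop_br br) (loop L)
           = {A + B | A B. A \<in> Der_tensor_laurent scale br L \<and> B \<in> Cent_tensor_Der_laurent scale br L}
       \<and> Der_tensor_laurent scale br L \<inter> Cent_tensor_Der_laurent scale br L = {0}
       \<and> (\<forall>D \<in> Der (pm_scale scale) (loop_br br) (loop L).
             almost_inner_derivation (loop_br br) (loop L) D \<longrightarrow>
             inner_derivation (loop_br br) (loop L) D)"
proof -
  interpret finite_dimensional_vector_space scale Basis by fact
  interpret lie_algebra scale br by fact
  interpret finite_dimensional_lie_algebra scale br Basis ..
  have "torus scale br H" using assms(4) by (simp add: maximal_torus_def)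
  moreover have "Q_graded scale br H L" using assms(5) by (simp add: minimal_Q_graded_def)
  ultimately obtain \<Psi> :: "('a \<Rightarrow> 'f) set" and h e
    where "sum_of_affine_algebras scale br \<Psi> h e L"
    using Q_graded_sum_of_affine_algebras[OF assms(3) _ _ assms(6)] by blast
  then interpret sum_of_affine_algebras scale br \<Psi> h e L .
  show ?thesis
    using Der_loop_eq Der_tensor_laurent_Int_Cent_tensor_Der_laurent[OF subalgebra_L]
      almost_inner_imp_inner by blast
qed

end
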